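(* Let $N\ge1$, let $m$ be an odd positive integer, let $q=\varepsilon$ be a primitive $m$th root of unity, and let $V$ be an irreducible module of $F_q(N)$. Let $\underline a=(a_0,\dots,a_{N-1},a_{N-1}^*,\dots,a_0^* )\in\mathbb C^{2N}$ be the point such that the central elements $z_i^m$ and $(z_i^* )^m$ act on $V$ as the scalars $a_i$ and $a_i^*$ respectively ($i=0,\dots,N-1$), and let $\mathcal O_{\underline a}$ be the symplectic leaf containing $\underline a$. Then the De Concini-Kac-Procesi Conjecture is true in this case; specifically, $$\dim V=m^{\frac12\dim\mathcal O_{\underline a}}.$$
   Context: $F_q(N)$ is the associative unital $\mathbb C$-algebra generated by $z_0,\dots,z_{N-1},z_0^*,\dots,z_{N-1}^*$ subject to $z_iz_j=q^{-1}z_jz_i$ for $i<j$; $z_i^*z_j^*=q\,z_j^*z_i^*$ for $i<j$; $z_iz_j^*=q^{-1}z_j^*z_i$ for $i\neq j$; $z_iz_i^*-z_i^*z_i=(q^2-1)\sum_{k>i}z_kz_k^*$. At $q=\varepsilon$ the $m$th powers of the generators are central, and irreducible modules are finite-dimensional. Symplectic leaves are those of the Poisson structure on $\mathbb C^{2N}$ (coordinates $a_i,a_i^*$, corresponding to $z_i^m,(z_i^* )^m$) given by $\{a_i,a_j\}=-a_ia_j$ for $i<j$; $\{a_i^*,a_j^*\}=a_i^*a_j^*$ for $i<j$; $\{a_i,a_j^*\}=-a_ia_j^*$ for $i\neq j$; $\{a_i,a_i^*\}=2\sum_{k>i}a_ka_k^*$. (This is the structure induced by $\lim_{q\to\varepsilon}\frac{[x^m,y^m]}{m(q^m-1)}$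 for generators $x,y$.) A symplectic leaf is a connected submanifold which is a maximal integral manifold of the distribution spanned by the (holomorphic) Hamiltonian vector fields; its dimension is the complex dimension. The De Concini-Kac-Procesi Conjecture asserts that $\dim\pi=m^{\frac12\dim\mathcal O_\pi}$ for an irreducible representation $\pi$, where $\mathcal O_\pi$ is the leaf containing the point given by the values of the $m$th powers of the generators on $\pi$. *)

theory Defs
  imports "HOL-Analysis.Analysis" "HOL-Library.Poly_Mapping" "HOL-Algebra.QuotRing"
begin

text \<open>
  Throughout, the index set \<open>{0, \<dots>, N - 1}\<close> is an arbitrary type \<open>'n\<close> of sort
  \<open>{finite, linorder}\<close>, so that \<open>N = CARD('n) \<ge> 1\<close>. Both the generators of the algebra and the
  coordinates of the Poisson space are indexed by \<open>'n + 'n\<close>: the unstarred ones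
  (\<open>z\<^sub>i\<close>, \<open>a\<^sub>i\<close>) by \<open>Inl i\<close>, the starred ones by \<open>Inr i\<close>.
\<close>

section \<open>The algebra\<close>

datatype 'g word = Word "'g list"

instantiation word :: (type) monoid_add
begin

definition zero_word :: "'g word" where
  "zero_word = Word []"

fun plus_word :: "'g word \<Rightarrow> 'g word \<Rightarrow> 'g word" where
  "plus_word (Word xs) (Word ys) = Word (xs @ ys)"

instance
proof
  fix u v w :: "'g word"
  show "u + v + w = u + (v + w)" by (cases u; cases v; cases w) simp
  show "0 + u = u" "u + 0 = u" by (cases u; simp add: zero_word_def)+
qed

end

text \<open>The free algebra on \<open>'g\<close> is the monoid algebra of the free monoid; its
  multiplication is the convolution product of finitely supported functions.\<close>

type_synonym 'g free_alg = "'g word \<Rightarrow>\<^sub>0 complex"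

definition const_alg :: "complex \<Rightarrow> 'g free_alg" where
  "const_alg c = Poly_Mapping.single 0 c"

definition var_alg :: "'g \<Rightarrow> 'g free_alg" where
  "var_alg g = Poly_Mapping.single (Word [g]) 1"

definition free_algebra :: "'g free_alg ring" where
  "free_algebra = \<lparr>carrier = UNIV, mult = (*), one = 1, zero = 0, add = (+)\<rparr>"

definition Fq_relations :: "complex \<Rightarrow> ('n::{finite,linorder} + 'n) free_alg set" where
  "Fq_relations q =
    (let z = (\<lambda>i. var_alg (Inl i)); zs = (\<lambda>i. var_alg (Inr i)) in
      {z i * z j - const_alg (inverse q) * z j * z i | i j. i < j}
    \<union> {zs i * zs j - const_alg q * zs j * zs i | i j. i < j}
    \<union> {z i * zs j - const_alg (inverse q) * zs j * z i | i j. i \<noteq> j}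
    \<union> {z i * zs i - zs i * z i - const_alg (q\<^sup>2 - 1) * (\<Sum>k\<in>{k. i < k}. z k * zs k) | i. True})"

definition Fq_ideal :: "complex \<Rightarrow> ('n::{finite,linorder} + 'n) free_alg set" where
  "Fq_ideal q = genideal free_algebra (Fq_relations q)"

definition Fq :: "complex \<Rightarrow> ('n::{finite,linorder} + 'n) free_alg set ring" where
  "Fq q = free_algebra Quot Fq_ideal q"

definition Fq_class :: "complex \<Rightarrow> ('n::{finite,linorder} + 'n) free_alg \<Rightarrow> ('n + 'n) free_alg set" where
  "Fq_class q x = Fq_ideal q +>\<^bsub>free_algebra\<^esub> x"

abbreviation Fq_z :: "complex \<Rightarrow> 'n::{finite,linorder} \<Rightarrow> ('n + 'n) free_alg set" where
  "Fq_z q i \<equiv> Fq_class q (var_alg (Inl i))"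

abbreviation Fq_zstar :: "complex \<Rightarrow> 'n::{finite,linorder} \<Rightarrow> ('n + 'n) free_alg set" where
  "Fq_zstar q i \<equiv> Fq_class q (var_alg (Inr i))"

section \<open>Irreducible modules\<close>

definition End_ring :: "(complex \<Rightarrow> 'v \<Rightarrow> 'v) \<Rightarrow> ('v::ab_group_add \<Rightarrow> 'v) ring" where
  "End_ring smul = \<lparr>carrier = {f. Vector_Spaces.linear smul smul f}, mult = (\<circ>), one = id,
     zero = (\<lambda>v. 0), add = (\<lambda>f g v. f v + g v)\<rparr>"

text \<open>A module is a complex vector space, here the whole type \<open>'v\<close> with scalar multiplication
  \<open>smul\<close>, with a unital algebra homomorphism \<open>\<rho>\<close> into its endomorphisms.\<close>

definition Fq_module ::
  "complex \<Rightarrow> (complex \<Rightarrow> 'v::ab_group_add \<Rightarrow> 'v) \<Rightarrow>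
    (('n::{finite,linorder} + 'n) free_alg set \<Rightarrow> 'v \<Rightarrow> 'v) \<Rightarrow> bool" where
  "Fq_module q smul \<rho> \<longleftrightarrow>
     vector_space smul \<and> \<rho> \<in> ring_hom (Fq q) (End_ring smul) \<and>
     (\<forall>c. \<rho> (Fq_class q (const_alg c)) = smul c)"

definition irreducible_Fq_module ::
  "complex \<Rightarrow> (complex \<Rightarrow> 'v::ab_group_add \<Rightarrow> 'v) \<Rightarrow>
    (('n::{finite,linorder} + 'n) free_alg set \<Rightarrow> 'v \<Rightarrow> 'v) \<Rightarrow> bool" where
  "irreducible_Fq_module q smul \<rho> \<longleftrightarrow>
     Fq_module q smul \<rho> \<and> (UNIV :: 'v set) \<noteq> {0} \<and>
     (\<forall>U. module.subspace smul U \<and> (\<forall>x\<in>carrier (Fq q). \<forall>u\<in>U. \<rho> x u \<in> U)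
        \<longrightarrow> U = {0} \<or> U = UNIV)"

definition primitive_root_of_unity :: "nat \<Rightarrow> complex \<Rightarrow> bool" where
  "primitive_root_of_unity m q \<longleftrightarrow> m > 0 \<and> q ^ m = 1 \<and> (\<forall>k. 0 < k \<and> k < m \<longrightarrow> q ^ k \<noteq> 1)"

section \<open>The Poisson structure\<close>

fun coord_bracket ::
  "'n::{finite,linorder} + 'n \<Rightarrow> 'n + 'n \<Rightarrow> complex ^ ('n + 'n) \<Rightarrow> complex" where
  "coord_bracket (Inl i) (Inl j) a =
     (if i < j then - (a $ Inl i * a $ Inl j) else if j < i then a $ Inl j * a $ Inl i else 0)"
| "coord_bracket (Inr i) (Inr j) a =
     (if i < j then a $ Inr i * a $ Inr j else if j < i then - (a $ Inr j * a $ Inr i) else 0)"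
| "coord_bracket (Inl i) (Inr j) a =
     (if i = j then 2 * (\<Sum>k\<in>{k. i < k}. a $ Inl k * a $ Inr k) else - (a $ Inl i * a $ Inr j))"
| "coord_bracket (Inr j) (Inl i) a =
     (if i = j then - (2 * (\<Sum>k\<in>{k. i < k}. a $ Inl k * a $ Inr k)) else a $ Inl i * a $ Inr j)"

definition entire :: "(complex ^ 'k \<Rightarrow> complex) \<Rightarrow> bool" where
  "entire f \<longleftrightarrow> (\<forall>a. \<exists>D. (f has_derivative D) (at a) \<and> (\<forall>c v. D (c *s v) = c * D v))"

definition partial_deriv :: "'k::finite \<Rightarrow> (complex ^ 'k \<Rightarrow> complex) \<Rightarrow> complex ^ 'k \<Rightarrow> complex" where
  "partial_deriv b f a = deriv (\<lambda>t. f (a + t *s axis b 1)) 0"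

definition poisson_bracket ::
  "(complex ^ ('n::{finite,linorder} + 'n) \<Rightarrow> complex) \<Rightarrow> (complex ^ ('n + 'n) \<Rightarrow> complex)
     \<Rightarrow> complex ^ ('n + 'n) \<Rightarrow> complex" where
  "poisson_bracket f g a =
     (\<Sum>b\<in>UNIV. \<Sum>c\<in>UNIV. partial_deriv b f a * partial_deriv c g a * coord_bracket b c a)"

definition hamiltonian_field ::
  "(complex ^ ('n::{finite,linorder} + 'n) \<Rightarrow> complex) \<Rightarrow> complex ^ ('n + 'n) \<Rightarrow> complex ^ ('n + 'n)" where
  "hamiltonian_field f a = (\<chi> c. poisson_bracket f (\<lambda>x. x $ c) a)"

definition hamiltonian_distribution ::
  "complex ^ ('n::{finite,linorder} + 'n) \<Rightarrow> (complex ^ ('n + 'n)) set" where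
  "hamiltonian_distribution a = vec.span {hamiltonian_field f a | f. entire f}"

section \<open>Integral manifolds and symplectic leaves\<close>

text \<open>
  Leaves are in general only injectively immersed, so a submanifold of \<open>\<complex>\<^sup>k\<close> is represented
  by a topology \<open>M\<close>, possibly finer than the subspace topology, on the subset \<open>topspace M\<close>.
  Charts are local parametrisations defined on open subsets \<open>B\<close> of a complex linear subspace
  \<open>W\<close> of \<open>\<complex>\<^sup>k\<close>, a \<open>d\<close>-dimensional \<open>W\<close> being the model space \<open>\<complex>\<^sup>d\<close>. As charts are holomorphic
  immersions into \<open>\<complex>\<^sup>k\<close>, compatibility of charts and the Hausdorff property are automatic,
  and so is second countability when \<open>M\<close> is connected.
\<close>

definition holomorphic_chart ::
  "(complex ^ 'k) topology \<Rightarrow> (complex ^ 'k) set \<Rightarrow> (complex ^ 'k) set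
     \<Rightarrow> (complex ^ 'k::finite \<Rightarrow> complex ^ 'k) \<Rightarrow> bool" where
  "holomorphic_chart M W B \<phi> \<longleftrightarrow>
     vec.subspace W \<and> openin (top_of_set W) B \<and> openin M (\<phi> ` B) \<and>
     homeomorphic_map (top_of_set B) (subtopology M (\<phi> ` B)) \<phi> \<and>
     (\<forall>x\<in>B. \<exists>D. (\<phi> has_derivative D) (at x within B) \<and>
        (\<forall>c. \<forall>w\<in>W. D (c *s w) = c *s D w) \<and> inj_on D W)"

definition immersed_submanifold :: "nat \<Rightarrow> (complex ^ 'k::finite) topology \<Rightarrow> bool" where
  "immersed_submanifold d M \<longleftrightarrow>
     (\<forall>p\<in>topspace M. \<exists>W B \<phi>. holomorphic_chart M W B \<phi> \<and> vec.dim W = d \<and> p \<in> \<phi> ` B)"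

text \<open>The derivative of a chart within \<open>B\<close> is determined on \<open>W\<close>, and the tangent space of
  \<open>M\<close> at \<open>\<phi> x\<close> is the image of \<open>W\<close>.\<close>

definition integral_manifold ::
  "(complex ^ 'k \<Rightarrow> (complex ^ 'k) set) \<Rightarrow> nat \<Rightarrow> (complex ^ 'k::finite) topology \<Rightarrow> bool" where
  "integral_manifold \<Delta> d M \<longleftrightarrow>
     immersed_submanifold d M \<and>
     (\<forall>W B \<phi> x D. holomorphic_chart M W B \<phi> \<and> x \<in> B \<and> (\<phi> has_derivative D) (at x within B)
        \<longrightarrow> D ` W = \<Delta> (\<phi> x))"

definition symplectic_leaf ::
  "nat \<Rightarrow> (complex ^ ('n::{finite,linorder} + 'n)) topology \<Rightarrow> bool" where
  "symplectic_leaf d M \<longleftrightarrow>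
     connected_space M \<and> integral_manifold hamiltonian_distribution d M \<and>
     (\<forall>d' M'. connected_space M' \<and> integral_manifold hamiltonian_distribution d' M' \<and>
        topspace M \<subseteq> topspace M' \<longrightarrow> M' = M)"

end

theory Submission
  imports Defs
begin

text \<open>
  A leaf through \<open>a\<close> has tangent space the span of the Hamiltonian vectors at \<open>a\<close>, so its dimension
  is the rank of the Poisson bivector at \<open>a\<close>, and it suffices to compare this rank with \<open>dim V\<close>.
  Both are computed by removing the generators with the smallest index \<open>b\<close>, one pair at a time.
  The elements \<open>\<Omega>\<^sub>i = \<Sum>\<^bsub>k\<ge>i\<^esub> z\<^sub>k z\<^sub>k\<^sup>*\<close> commute with the generators of index at least \<open>i\<close>,
  \<open>q\<^sup>2\<close>-commute with the others, and satisfy \<open>\<Omega>\<^sub>i\<^sup>m = \<Sum>\<^bsub>k\<ge>i\<^esub> a\<^sub>k a\<^sub>k\<^sup>*\<close> on \<open>V\<close>.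
  If the successor \<open>\<Omega>\<close> of \<open>\<Omega>\<^sub>b\<close> is invertible, its \<open>m\<close> eigenspaces are permuted cyclically by
  \<open>z\<^sub>b\<close>, each of them is irreducible over the remaining generators, and the rank drops by \<open>2\<close>.
  If it is nilpotent, it vanishes on \<open>V\<close>; then \<open>z\<^sub>b\<close> and \<open>z\<^sub>b\<^sup>*\<close> either both vanish or are,
  up to scalars, powers of one invertible operator that \<open>q\<close>-commutes with the remaining generators.
  In the second case this operator is kept as a grading; the quotient of it by the next such operator
  commutes with everything of larger index, and its eigenspaces remove both operators at once.
\<close>

section \<open>Operators on a complex vector space\<close>

text \<open>\<open>V\<close> may a priori be infinite-dimensional. Eigenspaces are therefore cut out
  by explicit averages over roots of unity, available because \<open>m\<close>th powers act as
  scalars, and finiteness comes out of the induction. Oddness of \<open>m\<close> makes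
  \<open>q\<^sup>2\<close> again a primitive \<open>m\<close>th root of unity; this is why the
  \<open>m\<close>th powers of the \<Omega> are sums of the products of central values, and why
  \<open>m\<close> different eigenspaces occur.

  The obstacle is the case where the next \<Omega> vanishes on \<open>V\<close> while a generator of
  index \<open>b\<close> is invertible: half of a pair is left over and no factor \<open>m\<close>
  can be split off yet. The induction thus has two states, without and with one leftover operator
  that scales all remaining generators by the same factor. In the second state \<Omega> of the
  remaining indices vanishes, and the next index with a nonzero coordinate supplies the other half,
  so there is never more than one leftover. If no such index comes, the leftover is a scalar by
  Schur's lemma. The Poisson counterpart of the second state is the bivector bordered by one
  coordinate; each factor \<open>m\<close> corresponds to an increase of the rank by 2.\<close>

locale complex_vector_space = vector_space scale
  for scale :: "complex \<Rightarrow> 'v::ab_group_add \<Rightarrow> 'v" (infixr \<open>\<cdot>\<close> 75)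
begin

abbreviation lin :: "('v \<Rightarrow> 'v) \<Rightarrow> bool" where
  "lin \<equiv> Vector_Spaces.linear scale scale"

interpretation vp: vector_space_pair scale scale ..

lemma lin_iff: "lin T \<longleftrightarrow> (\<forall>x y. T (x + y) = T x + T y) \<and> (\<forall>c x. T (c \<cdot> x) = c \<cdot> T x)"
  unfolding Vector_Spaces.linear_iff using vector_space_axioms by blast

lemma lin_add: "lin T \<Longrightarrow> T (x + y) = T x + T y"
  and lin_scale: "lin T \<Longrightarrow> T (c \<cdot> x) = c \<cdot> T x"
  by (simp_all add: lin_iff)

lemma lin_0: "lin T \<Longrightarrow> T 0 = 0"
  and lin_diff: "lin T \<Longrightarrow> T (x - y) = T x - T y"
  and lin_minus: "lin T \<Longrightarrow> T (- x) = - T x"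
  and lin_sum: "lin T \<Longrightarrow> T (sum f A) = (\<Sum>i\<in>A. T (f i))"
  by (simp_all add: vp.linear_0 vp.linear_diff vp.linear_neg vp.linear_sum)

lemmas lin_simps = lin_add lin_scale lin_0 lin_diff lin_minus lin_sum

lemma lin_comp: "lin S \<Longrightarrow> lin T \<Longrightarrow> lin (\<lambda>v. S (T v))"
  by (simp add: lin_iff)

lemma lin_funpow: "lin T \<Longrightarrow> lin (T ^^ n)"
  by (induction n) (simp_all add: lin_iff)

lemma lin_sum_ops: "(\<And>i. i \<in> A \<Longrightarrow> lin (T i)) \<Longrightarrow> lin (\<lambda>v. \<Sum>i\<in>A. T i v)"
  unfolding lin_iff by (simp add: sum.distrib scale_sum_right)

lemma funpow_in: "T ` W \<subseteq> W \<Longrightarrow> v \<in> W \<Longrightarrow> (T ^^ n) v \<in> W"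
  by (induction n) auto

lemma funpow_eigen: "lin T \<Longrightarrow> T v = c \<cdot> v \<Longrightarrow> (T ^^ n) v = c ^ n \<cdot> v"
  by (induction n) (simp_all add: lin_simps mult.commute)

lemma funpow_commute:
  assumes "lin S" "lin T" "S ` W \<subseteq> W" "\<And>v. v \<in> W \<Longrightarrow> T (S v) = c \<cdot> S (T v)" "v \<in> W"
  shows "T ((S ^^ n) v) = c ^ n \<cdot> (S ^^ n) (T v)"
proof (induction n)
  case (Suc n)
  have "T ((S ^^ Suc n) v) = c \<cdot> S (T ((S ^^ n) v))"
    using assms(4)[OF funpow_in[OF assms(3,5)]] by simp
  then show ?case
    using assms by (simp add: Suc lin_simps mult.commute)
qed simp

lemma funpow_commute_left:
  assumes "lin S" "lin T" "T ` W \<subseteq> W" "\<And>v. v \<in> W \<Longrightarrow> T (S v) = c \<cdot> S (T v)" "v \<in> W"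
  shows "(T ^^ n) (S v) = c ^ n \<cdot> S ((T ^^ n) v)"
proof (induction n)
  case (Suc n)
  have "(T ^^ Suc n) (S v) = c ^ n \<cdot> T (S ((T ^^ n) v))"
    using assms by (simp add: Suc lin_simps)
  also have "\<dots> = c ^ n \<cdot> c \<cdot> S (T ((T ^^ n) v))"
    using assms(4)[OF funpow_in[OF assms(3,5)]] by simp
  finally show ?case
    by (simp add: mult.commute)
qed simp

section \<open>Eigenspaces of an operator whose \<open>m\<close>th power is a scalar\<close>

definition eigenspace :: "('v \<Rightarrow> 'v) \<Rightarrow> complex \<Rightarrow> 'v set \<Rightarrow> 'v set" where
  "eigenspace T c W = {v \<in> W. T v = c \<cdot> v}"

lemma subspace_eigenspace: "lin T \<Longrightarrow> subspace W \<Longrightarrow> subspace (eigenspace T c W)"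
  unfolding eigenspace_def subspace_def
  by (auto simp: lin_simps scale_right_distrib scale_left_commute)

lemma eigenspace_stable:
  assumes "lin S" "S ` W \<subseteq> W" "\<And>v. v \<in> W \<Longrightarrow> T (S v) = S (T v)"
  shows "S ` eigenspace T c W \<subseteq> eigenspace T c W"
  unfolding eigenspace_def using assms by (auto simp: lin_simps)

text \<open>The projection onto the \<open>c\<close>-eigenspace of an operator whose \<open>m\<close>th power is \<open>c ^ m\<close>.\<close>

definition eigenproj :: "nat \<Rightarrow> ('v \<Rightarrow> 'v) \<Rightarrow> complex \<Rightarrow> 'v \<Rightarrow> 'v" where
  "eigenproj m T c v = (1 / of_nat m) \<cdot> (\<Sum>j<m. inverse c ^ j \<cdot> (T ^^ j) v)"

lemma lin_eigenproj: "lin T \<Longrightarrow> lin (eigenproj m T c)"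
  unfolding eigenproj_def using lin_funpow[of T]
  by (simp add: lin_iff sum.distrib scale_right_distrib scale_sum_right mult.left_commute mult.commute)

lemma eigenproj_in:
  assumes "subspace W" "T ` W \<subseteq> W" "v \<in> W"
  shows "eigenproj m T c v \<in> W"
  unfolding eigenproj_def
  by (intro subspace_scale subspace_sum assms funpow_in)

text \<open>\<open>T\<close> sends each term of the average to \<open>c\<close> times the next one,
  and the hypothesis on \<open>(T ^^ m) v\<close> makes the last term wrap around to the
  first.\<close>

lemma eigenproj_eigen:
  assumes T: "lin T" and c: "c \<noteq> 0" and v: "(T ^^ m) v = c ^ m \<cdot> v"
  shows "T (eigenproj m T c v) = c \<cdot> eigenproj m T c v"
proof -
  define g where "g j = inverse c ^ j \<cdot> (T ^^ j) v" for j
  have gm: "g m = g 0"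
    using c by (simp add: g_def v power_inverse)
  have "(\<Sum>j<Suc m. g j) = g 0 + (\<Sum>j<m. g (Suc j))"
    by (rule sum.lessThan_Suc_shift)
  then have shift: "(\<Sum>j<m. g (Suc j)) = (\<Sum>j<m. g j)"
    by (simp add: gm)
  have "T (g j) = c \<cdot> g (Suc j)" for j
    using T c by (simp add: g_def lin_simps)
  then have "T (\<Sum>j<m. g j) = (\<Sum>j<m. c \<cdot> g (Suc j))"
    using T by (simp add: lin_sum)
  then have "T (\<Sum>j<m. g j) = c \<cdot> (\<Sum>j<m. g j)"
    by (simp only: shift flip: scale_sum_right)
  then show ?thesis
    unfolding eigenproj_def g_def[symmetric] using T
    by (simp add: lin_scale mult.commute del: scale_sum_right)
qed

text \<open>On an eigenvector the average is a geometric sum in \<open>c' / c\<close>, an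
  \<open>m\<close>th root of unity.\<close>

lemma eigenproj_of_eigenvector:
  assumes T: "lin T" and m: "m > 0" and c: "c \<noteq> 0" and v: "T v = c' \<cdot> v" and c': "c' ^ m = c ^ m"
  shows "eigenproj m T c v = (if c' = c then v else 0)"
proof -
  have "(\<Sum>j<m. inverse c ^ j \<cdot> (T ^^ j) v) = (\<Sum>j<m. (c' / c) ^ j \<cdot> v)"
    using funpow_eigen[OF T v] by (simp add: field_simps)
  also have "\<dots> = (\<Sum>j<m. (c' / c) ^ j) \<cdot> v"
    by (simp add: scale_sum_left)
  also have "(\<Sum>j<m. (c' / c) ^ j) = (if c' = c then of_nat m else 0)"
  proof (cases "c' = c")
    case False
    then have "c' / c \<noteq> 1" "(c' / c) ^ m = 1"
      using c c' by (simp_all add: power_divide)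
    then show ?thesis
      using False by (simp add: geometric_sum)
  qed (use c in simp)
  finally show ?thesis
    using m by (auto simp: eigenproj_def)
qed

text \<open>Orthogonality of characters: after exchanging the sums, the coefficient of
  \<open>(T ^^ j) v\<close> is, up to a factor, the sum of the first \<open>m\<close> powers of
  \<open>inverse (z ^ j)\<close>, which vanishes for \<open>0 < j < m\<close>.\<close>

lemma sum_eigenproj:
  assumes prim: "primitive_root_of_unity m z"
  shows "(\<Sum>k<m. eigenproj m T (c * z ^ k) v) = v"
proof -
  have m: "m > 0" and zm: "z ^ m = 1" and z: "0 < k \<Longrightarrow> k < m \<Longrightarrow> z ^ k \<noteq> 1" for k
    using prim by (auto simp: primitive_root_of_unity_def)
  have char: "(\<Sum>k<m. inverse (c * z ^ k) ^ j) = (if j = 0 then of_nat m else 0)" if "j < m" for j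
  proof (cases "j = 0")
    case False
    have "inverse (z ^ j) ^ m = 1"
      by (metis inverse_1 mult.commute power_inverse power_mult power_one zm)
    moreover have "inverse (z ^ j) \<noteq> 1"
      using z[of j] False that by (metis inverse_1 inverse_inverse_eq neq0_conv)
    ultimately have 0: "(\<Sum>k<m. inverse (z ^ j) ^ k) = 0"
      by (simp add: geometric_sum)
    have "(\<Sum>k<m. inverse (c * z ^ k) ^ j) = (\<Sum>k<m. inverse c ^ j * inverse (z ^ j) ^ k)"
    proof (rule sum.cong[OF refl])
      fix k
      have "(z ^ k) ^ j = (z ^ j) ^ k"
        by (metis mult.commute power_mult)
      then show "inverse (c * z ^ k) ^ j = inverse c ^ j * inverse (z ^ j) ^ k"
        by (simp only: inverse_mult_distrib power_mult_distrib power_inverse)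
    qed
    also have "\<dots> = 0"
      by (simp add: 0 flip: sum_distrib_left)
    finally show ?thesis
      using False by simp
  qed simp
  have "(\<Sum>k<m. \<Sum>j<m. inverse (c * z ^ k) ^ j \<cdot> (T ^^ j) v)
      = (\<Sum>j<m. (\<Sum>k<m. inverse (c * z ^ k) ^ j) \<cdot> (T ^^ j) v)"
    by (subst sum.swap) (simp add: scale_sum_left)
  also have "\<dots> = (\<Sum>j<m. if j = 0 then of_nat m \<cdot> v else 0)"
    by (intro sum.cong refl, subst char) auto
  also have "\<dots> = of_nat m \<cdot> v"
    using m by (simp add: sum.delta)
  finally show ?thesis
    using m by (simp add: eigenproj_def flip: scale_sum_right)
qed

section \<open>Irreducible families of operators and Schur's lemma\<close>

text \<open>The modules met in the induction are eigenspaces inside one fixed space. As subsets of a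
  single type they shrink together with \<open>G\<close>, while the operators, their relations and
  their powers stay the same.\<close>

definition irreducible_on :: "('v \<Rightarrow> 'v) set \<Rightarrow> 'v set \<Rightarrow> bool" where
  "irreducible_on G W \<longleftrightarrow> subspace W \<and> W \<noteq> {0} \<and> (\<forall>g\<in>G. lin g \<and> g ` W \<subseteq> W) \<and>
     (\<forall>U. subspace U \<and> U \<subseteq> W \<and> (\<forall>g\<in>G. g ` U \<subseteq> U) \<longrightarrow> U = {0} \<or> U = W)"

lemma irreducible_onD:
  assumes "irreducible_on G W"
  shows "subspace W" "W \<noteq> {0}" "g \<in> G \<Longrightarrow> lin g" "g \<in> G \<Longrightarrow> g ` W \<subseteq> W"
    "subspace U \<Longrightarrow> U \<subseteq> W \<Longrightarrow> (\<And>g. g \<in> G \<Longrightarrow> g ` U \<subseteq> U) \<Longrightarrow> U \<noteq> {0} \<Longrightarrow> U = W"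
proof -
  show "subspace W" "W \<noteq> {0}" "g \<in> G \<Longrightarrow> lin g" "g \<in> G \<Longrightarrow> g ` W \<subseteq> W"
    using assms by (simp_all add: irreducible_on_def)
  show "subspace U \<Longrightarrow> U \<subseteq> W \<Longrightarrow> (\<And>g. g \<in> G \<Longrightarrow> g ` U \<subseteq> U) \<Longrightarrow> U \<noteq> {0} \<Longrightarrow> U = W"
    using assms unfolding irreducible_on_def by blast
qed

text \<open>Used to replace generators on an unchanged space: the last premise asks that the new
  operators recover the old ones on stable subspaces, as when a dropped generator is a polynomial in
  those kept.\<close>

lemma irreducible_on_change:
  assumes "irreducible_on G W" "\<And>g. g \<in> G' \<Longrightarrow> lin g \<and> g ` W \<subseteq> W"
    and "\<And>U g. subspace U \<Longrightarrow> U \<subseteq> W \<Longrightarrow> (\<And>g. g \<in> G' \<Longrightarrow> g ` U \<subseteq> U) \<Longrightarrow> g \<in> G \<Longrightarrow> g ` U \<subseteq> U"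
  shows "irreducible_on G' W"
proof -
  have "U = {0} \<or> U = W" if "subspace U" "U \<subseteq> W" "\<forall>g\<in>G'. g ` U \<subseteq> U" for U
  proof -
    have "g ` U \<subseteq> U" if "g \<in> G" for g
      using assms(3)[OF \<open>subspace U\<close> \<open>U \<subseteq> W\<close> _ that] \<open>\<forall>g\<in>G'. g ` U \<subseteq> U\<close> by simp
    then show ?thesis
      using irreducible_onD(5)[OF assms(1) that(1,2)] by (cases "U = {0}") simp_all
  qed
  with irreducible_onD(1,2)[OF assms(1)] assms(2) show ?thesis
    unfolding irreducible_on_def by simp
qed

lemma ex_nonzero: "subspace W \<Longrightarrow> W \<noteq> {0} \<Longrightarrow> \<exists>v\<in>W. v \<noteq> 0"
  using subspace_0 by blast

text \<open>The kernel of \<open>T\<close> in \<open>W\<close> is stable under \<open>G\<close>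
  because \<open>T\<close> commutes with each member up to a scalar, and it is nonzero because
  \<open>T\<close> is nilpotent; irreducibility makes it all of \<open>W\<close>.\<close>

lemma nilpotent_normal_zero:
  assumes irr: "irreducible_on G W" and T: "lin T" "T ` W \<subseteq> W"
    and nil: "\<And>v. v \<in> W \<Longrightarrow> (T ^^ n) v = 0"
    and comm: "\<And>g. g \<in> G \<Longrightarrow> \<exists>c. \<forall>v\<in>W. T (g v) = c \<cdot> g (T v)"
    and v: "v \<in> W"
  shows "T v = 0"
proof -
  define U where "U = {v \<in> W. T v = 0}"
  obtain w where w: "w \<in> W" "w \<noteq> 0"
    using ex_nonzero irreducible_onD(1,2)[OF irr] by blast
  have "U \<noteq> {0}"
  proof -
    have ex: "\<exists>k. (T ^^ k) w = 0"
      using nil w by blast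
    \<comment> \<open>The last nonzero vector in the chain of iterates of \<open>w\<close> lies in
      the kernel.\<close>
    define k where "k = (LEAST k. (T ^^ k) w = 0)"
    have k: "(T ^^ k) w = 0"
      unfolding k_def using ex by (rule LeastI_ex)
    with w obtain j where j: "k = Suc j"
      by (cases k) auto
    have "(T ^^ j) w \<noteq> 0"
      using not_less_Least[of j "\<lambda>k. (T ^^ k) w = 0"] j k_def by auto
    moreover have "(T ^^ j) w \<in> U"
      using k j funpow_in[OF T(2) w(1)] by (auto simp: U_def)
    ultimately show ?thesis by blast
  qed
  moreover have "subspace U"
    unfolding U_def using subspace_eigenspace[OF T(1) irreducible_onD(1)[OF irr], of 0]
    by (simp add: eigenspace_def)
  moreover have "g ` U \<subseteq> U" if "g \<in> G" for g
    using comm[OF that] irreducible_onD(3,4)[OF irr that] by (fastforce simp: U_def lin_simps)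
  ultimately have "U = W"
    using irreducible_onD(5)[OF irr, of U] by (auto simp: U_def)
  with v show ?thesis
    by (auto simp: U_def)
qed

text \<open>Schur's lemma in possibly infinite dimension. For \<open>c \<noteq> 0\<close> an
  eigenvector comes from the eigenprojections, which sum to the identity and so cannot all kill
  \<open>w\<close>; for \<open>c = 0\<close> the operator is nilpotent.\<close>

lemma central_scalar:
  assumes irr: "irreducible_on G W" and T: "lin T" "T ` W \<subseteq> W" and m: "m > 0"
    and pow: "\<And>v. v \<in> W \<Longrightarrow> (T ^^ m) v = c \<cdot> v"
    and comm: "\<And>g v. g \<in> G \<Longrightarrow> v \<in> W \<Longrightarrow> T (g v) = g (T v)"
    and prim: "primitive_root_of_unity m z"
  obtains a where "a ^ m = c" "\<And>v. v \<in> W \<Longrightarrow> T v = a \<cdot> v"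
proof (cases "c = 0")
  case True
  have "T v = 0" if "v \<in> W" for v
  proof (rule nilpotent_normal_zero[OF irr T _ _ that])
    show "(T ^^ m) v = 0" if "v \<in> W" for v
      using pow that True by simp
    show "\<exists>c. \<forall>v\<in>W. T (g v) = c \<cdot> g (T v)" if "g \<in> G" for g
      using comm[OF that] by (intro exI[of _ 1]) simp
  qed
  then show ?thesis
    using that[of 0] True m by auto
next
  case False
  have "card {l. l ^ m = c} = m"
    by (rule card_nth_roots) (use False m in auto)
  then obtain l where l: "l ^ m = c"
    using m by (cases "{l. l ^ m = c} = {}") auto
  have "z ^ m = 1"
    using prim by (simp add: primitive_root_of_unity_def)
  then have z: "(z ^ k) ^ m = 1" for k
    by (metis mult.commute power_mult power_one)
  obtain w where w: "w \<in> W" "w \<noteq> 0"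
    using ex_nonzero irreducible_onD(1,2)[OF irr] by blast
  have "\<exists>k. eigenproj m T (l * z ^ k) w \<noteq> 0"
  proof (rule ccontr)
    assume "\<nexists>k. eigenproj m T (l * z ^ k) w \<noteq> 0"
    then show False
      using sum_eigenproj[OF prim, of T l w] w(2) by simp
  qed
  then obtain k where k: "eigenproj m T (l * z ^ k) w \<noteq> 0" ..
  define a where "a = l * z ^ k"
  have a: "a ^ m = c"
    using l z by (simp add: a_def power_mult_distrib)
  with False m have a0: "a \<noteq> 0"
    by (auto simp: power_0_left)
  have "eigenproj m T a w \<in> eigenspace T a W"
    using eigenproj_in[OF irreducible_onD(1)[OF irr] T(2) w(1)]
      eigenproj_eigen[OF T(1) a0] pow[OF w(1)] a by (simp add: eigenspace_def)
  then have "eigenspace T a W \<noteq> {0}"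
    using k by (auto simp: a_def)
  moreover have "g ` eigenspace T a W \<subseteq> eigenspace T a W" if "g \<in> G" for g
    using eigenspace_stable irreducible_onD(3,4)[OF irr that] comm[OF that] by blast
  ultimately have "eigenspace T a W = W"
    using irreducible_onD(5)[OF irr] subspace_eigenspace[OF T(1) irreducible_onD(1)[OF irr]]
    by (metis (mono_tags, lifting) eigenspace_def mem_Collect_eq subsetI)
  then show ?thesis
    using that[OF a] by (auto simp: eigenspace_def)
qed

section \<open>Finite dimension and direct sums\<close>

text \<open>\<open>dim\<close> is also 0 on a space with an infinite basis, so the finite basis is
  carried along explicitly.\<close>

definition has_dim :: "'v set \<Rightarrow> nat \<Rightarrow> bool" where
  "has_dim W n \<longleftrightarrow> (\<exists>B. finite B \<and> independent B \<and> span B = W \<and> card B = n)"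

lemma has_dim_imp_dim: "has_dim W n \<Longrightarrow> dim W = n"
  unfolding has_dim_def using dim_span_eq_card_independent by blast

lemma has_dim_0: "has_dim {0} 0"
  unfolding has_dim_def by (intro exI[of _ "{}"]) (simp add: independent_empty)

lemma has_dim_line: "v \<noteq> 0 \<Longrightarrow> has_dim (span {v}) 1"
  unfolding has_dim_def by (intro exI[of _ "{v}"]) auto

lemma has_dim_image:
  assumes "has_dim W n" "lin T" "inj_on T W"
  shows "has_dim (T ` W) n"
proof -
  obtain B where B: "finite B" "independent B" "span B = W" "card B = n"
    using assms(1) by (auto simp: has_dim_def)
  have "inj_on T B"
    using assms(3) B(3) span_superset inj_on_subset by blast
  then have "card (T ` B) = n"
    using B(4) by (simp add: card_image)
  moreover have "independent (T ` B)"
    using vp.linear_independent_injective_image[OF assms(2)] B assms(3) by simp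
  moreover have "span (T ` B) = T ` W"
    using vp.linear_span_image[OF assms(2)] B by simp
  ultimately show ?thesis
    using B(1) by (auto simp: has_dim_def)
qed

lemma independent_Un:
  assumes "independent B" "independent C" "span B \<inter> span C = {0}"
  shows "independent (B \<union> C)"
proof
  have key: False
    if "independent B" "span B \<inter> span C = {0}" "a \<in> B" "a \<in> span ((B \<union> C) - {a})" for a B C
  proof -
    have "(B \<union> C) - {a} = (B - {a}) \<union> (C - {a})" by blast
    then obtain x y where xy: "a = x + y" "x \<in> span (B - {a})" "y \<in> span (C - {a})"
      using \<open>a \<in> span ((B \<union> C) - {a})\<close> by (auto simp: span_Un)
    have "y = a - x"
      using xy by simp
    then have "y \<in> span B"
      using xy span_diff span_base \<open>a \<in> B\<close> span_mono[of "B - {a}" B] by blast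
    moreover have "y \<in> span C"
      using xy span_mono[of "C - {a}" C] by blast
    ultimately have "y = 0"
      using \<open>span B \<inter> span C = {0}\<close> by blast
    then show False
      using xy \<open>a \<in> B\<close> \<open>independent B\<close> dependent_def by auto
  qed
  assume "dependent (B \<union> C)"
  then obtain a where a: "a \<in> B \<union> C" "a \<in> span ((B \<union> C) - {a})"
    by (auto simp: dependent_def)
  show False
    using key[OF assms(1,3), of a] key[OF assms(2), of B a] a assms(3)
    by (auto simp: Un_commute Int_commute)
qed

lemma has_dim_sum:
  assumes "has_dim U k" "has_dim W n" "U \<inter> W = {0}"
  shows "has_dim (span (U \<union> W)) (k + n)"
proof -
  obtain B where B: "finite B" "independent B" "span B = U" "card B = k"
    using assms(1) by (auto simp: has_dim_def)
  obtain C where C: "finite C" "independent C" "span C = W" "card C = n"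
    using assms(2) by (auto simp: has_dim_def)
  have "0 \<notin> B"
    using B(2) dependent_zero by blast
  moreover have "B \<inter> C \<subseteq> {0}"
    using B(3) C(3) assms(3) span_superset[of B] span_superset[of C] by blast
  ultimately have "B \<inter> C = {}"
    by blast
  then have "card (B \<union> C) = k + n"
    using B C card_Un_disjoint by blast
  moreover have "independent (B \<union> C)"
    using independent_Un B C assms(3) by simp
  moreover have "span (B \<union> C) = span (U \<union> W)"
    using B(3) C(3) by (simp add: span_Un) (metis span_span)
  ultimately show ?thesis
    using B(1) C(1) by (auto simp: has_dim_def)
qed

text \<open>The operators \<open>Q k\<close> certify that the sum is direct: \<open>Q k\<close>
  fixes \<open>W k\<close> and kills the span of the preceding summands, so the two meet only in
  0.\<close>

lemma has_dim_graded:
  assumes "\<And>k. k < n \<Longrightarrow> has_dim (W k) r"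
    and "\<And>k. k < n \<Longrightarrow> lin (Q k)"
    and "\<And>k v. k < n \<Longrightarrow> v \<in> W k \<Longrightarrow> Q k v = v"
    and "\<And>j k v. k < n \<Longrightarrow> j < k \<Longrightarrow> v \<in> W j \<Longrightarrow> Q k v = 0"
  shows "has_dim (span (\<Union>k<n. W k)) (n * r)"
  using assms
proof (induction n)
  case 0
  then show ?case
    by (simp add: has_dim_0)
next
  case (Suc n)
  let ?U = "span (\<Union>k<n. W k)"
  have U: "has_dim ?U (n * r)"
    using Suc by simp
  have sub: "subspace (W n)"
    using Suc.prems(1)[of n] by (metis has_dim_def lessI subspace_span)
  have Q0: "Q n v = 0" if "v \<in> ?U" for v
  proof (rule vp.linear_eq_0_on_span[OF _ _ that])
    show "lin (Q n)"
      using Suc.prems by simp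
    show "Q n x = 0" if "x \<in> (\<Union>k<n. W k)" for x
      using Suc.prems(4) that by auto
  qed
  have "?U \<inter> W n \<subseteq> {0}"
  proof
    fix v
    assume "v \<in> ?U \<inter> W n"
    then show "v \<in> {0}"
      using Q0[of v] Suc.prems(3)[of n v] by auto
  qed
  moreover have "0 \<in> ?U \<inter> W n"
    using span_zero subspace_0[OF sub] by blast
  ultimately have "?U \<inter> W n = {0}"
    by blast
  then have "has_dim (span (?U \<union> W n)) (n * r + r)"
    using has_dim_sum[OF U] Suc.prems(1)[of n] by simp
  moreover have "span (?U \<union> W n) = span (\<Union>k<Suc n. W k)"
  proof -
    have "span (\<Union>k<Suc n. W k) = span ((\<Union>k<n. W k) \<union> W n)"
      by (simp add: lessThan_Suc Un_commute)
    then show ?thesis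
      by (simp only: span_Un span_span)
  qed
  ultimately show ?case
    by (simp add: add.commute)
qed

section \<open>Operators that rotate the eigenspaces of another operator\<close>

lemma span_stable:
  assumes "lin T" "\<And>x. x \<in> S \<Longrightarrow> T x \<in> span S"
  shows "T ` span S \<subseteq> span S"
proof -
  have "span (T ` S) \<subseteq> span S"
    using assms(2) by (intro span_minimal) auto
  then show ?thesis
    using vp.linear_span_image[OF assms(1)] by simp
qed

text \<open>The operator \<open>u\<close> permutes the eigenspaces of \<open>h\<close> cyclically. Every arrow of this cycle but the
  one that closes it is bijective, because its composite with \<open>w\<close> is a nonzero scalar.\<close>

theorem clock_reduction:
  assumes prim: "primitive_root_of_unity m z"
    and irr: "irreducible_on (insert h (insert u (insert w G))) W"
    and l: "l \<noteq> 0" and hpow: "\<And>v. v \<in> W \<Longrightarrow> (h ^^ m) v = l ^ m \<cdot> v"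
    and hu: "\<And>v. v \<in> W \<Longrightarrow> h (u v) = z \<cdot> u (h v)"
    and hw: "\<And>v. v \<in> W \<Longrightarrow> h (w v) = inverse z \<cdot> w (h v)"
    and hg: "\<And>g v. g \<in> G \<Longrightarrow> v \<in> W \<Longrightarrow> h (g v) = g (h v)"
    and gu: "\<And>g. g \<in> G \<Longrightarrow> \<exists>c. \<forall>v\<in>W. g (u v) = c \<cdot> u (g v)"
    and gw: "\<And>g. g \<in> G \<Longrightarrow> \<exists>c. \<forall>v\<in>W. g (w v) = c \<cdot> w (g v)"
    and upow: "\<And>v. v \<in> W \<Longrightarrow> (u ^^ m) v = \<alpha> \<cdot> v"
    and wpow: "\<And>v. v \<in> W \<Longrightarrow> (w ^^ m) v = \<beta> \<cdot> v"
    and uw: "\<And>c v. v \<in> eigenspace h c W \<Longrightarrow> u (w v) = f c \<cdot> v"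
    and wu: "\<And>c v. v \<in> eigenspace h c W \<Longrightarrow> w (u v) = f (c * z) \<cdot> v"
    and f: "\<And>k. 0 < k \<Longrightarrow> k < m \<Longrightarrow> f (l * z ^ k) \<noteq> 0"
  shows "irreducible_on G (eigenspace h l W)"
    and "has_dim (eigenspace h l W) n \<Longrightarrow> has_dim W (m * n)"
proof -
  define E where "E c = eigenspace h c W" for c
  have m: "m > 0" and zm: "z ^ m = 1" and zk: "0 < k \<Longrightarrow> k < m \<Longrightarrow> z ^ k \<noteq> 1" for k
    using prim by (auto simp: primitive_root_of_unity_def)
  have z0: "z \<noteq> 0"
    using zm m by (auto simp: power_0_left)
  note W = irreducible_onD(1)[OF irr]
  have lins: "lin h" "lin u" "lin w" "\<And>g. g \<in> G \<Longrightarrow> lin g"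
    and stab: "h ` W \<subseteq> W" "u ` W \<subseteq> W" "w ` W \<subseteq> W" "\<And>g. g \<in> G \<Longrightarrow> g ` W \<subseteq> W"
    using irreducible_onD(3,4)[OF irr] by simp_all
  have subE: "subspace (E c)" and EW: "E c \<subseteq> W" for c
    using subspace_eigenspace[OF lins(1) W] by (auto simp: E_def eigenspace_def)
  have uE: "u v \<in> E (c * z)" and wE: "w v \<in> E (c * inverse z)" if "v \<in> E c" for v c
    using that hu[of v] hw[of v] stab lins by (auto simp: E_def eigenspace_def lin_scale mult.commute)
  have ukE: "(u ^^ k) v \<in> E (l * z ^ k)" and wkE: "(w ^^ k) v \<in> E (l * inverse z ^ k)"
    if "v \<in> E l" for v k
    using that by (induction k) (auto dest: uE wE simp: mult_ac)
  have powlz: "(l * z ^ k) ^ m = l ^ m" "(l * inverse z ^ k) ^ m = l ^ m" for k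
    using zm by (simp_all add: power_mult_distrib power_inverse)
      (metis mult.commute power_mult power_one)+
  have lz0: "l * z ^ k \<noteq> 0" for k
    using l z0 by simp
  have proj_E: "eigenproj m h (l * z ^ k) v \<in> E (l * z ^ k)" if "v \<in> W" for k v
    using eigenproj_in[OF W stab(1) that] eigenproj_eigen[OF lins(1) lz0, of m v k] hpow[OF that] powlz
    by (simp add: E_def eigenspace_def)
  have proj_of_E: "eigenproj m h c v = (if c' = c then v else 0)"
    if "v \<in> E c'" "c' ^ m = c ^ m" "c \<noteq> 0" for c c' v
    using eigenproj_of_eigenvector[OF lins(1) m] that by (auto simp: E_def eigenspace_def)
  \<comment> \<open>By \<open>uw\<close>, dividing \<open>w\<close> by the scalar
    \<open>f (c * z)\<close> gives a right inverse of \<open>u\<close> on \<open>E (c * z)\<close>;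
    by \<open>wu\<close>, the same scalar forces injectivity.\<close>
  have bij: "u ` E c = E (c * z)" "inj_on u (E c)" if "f (c * z) \<noteq> 0" for c
  proof -
    show "inj_on u (E c)"
    proof (rule inj_onI)
      fix x y assume xy: "x \<in> E c" "y \<in> E c" "u x = u y"
      then have "f (c * z) \<cdot> x = f (c * z) \<cdot> y"
        using wu by (metis E_def)
      with that show "x = y" by simp
    qed
    have "v \<in> u ` E c" if v: "v \<in> E (c * z)" for v
    proof
      have "u (w v) = f (c * z) \<cdot> v"
        using uw v by (simp add: E_def)
      then show "v = u (inverse (f (c * z)) \<cdot> w v)"
        using lins \<open>f (c * z) \<noteq> 0\<close> by (simp add: lin_scale)
      show "inverse (f (c * z)) \<cdot> w v \<in> E c"
        using wE[OF v] z0 subspace_scale[OF subE] by (simp add: mult.assoc)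
    qed
    then show "u ` E c = E (c * z)"
      using uE by blast
  qed
  \<comment> \<open>The arrow leaving index \<open>m - 1\<close> is excluded: its scalar is
    \<open>f (l * z ^ m) = f l\<close>, which may be 0.\<close>
  have fk: "f (l * z ^ k * z) \<noteq> 0" if "Suc k < m" for k
    using f[of "Suc k"] that by (simp add: mult_ac)
  have Ek: "E (l * z ^ k) = (u ^^ k) ` E l" if "k < m" for k
    using that
  proof (induction k)
    case (Suc k)
    have "E (l * z ^ Suc k) = u ` E (l * z ^ k)"
      using bij(1)[OF fk[OF Suc.prems]] by (simp add: mult_ac)
    then show ?case
      using Suc by (simp add: image_comp)
  qed simp
  have span_E: "W = span (\<Union>k<m. E (l * z ^ k))"
  proof
    show "span (\<Union>k<m. E (l * z ^ k)) \<subseteq> W"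
      using EW by (intro span_minimal W) blast
    show "W \<subseteq> span (\<Union>k<m. E (l * z ^ k))"
    proof
      fix v assume v: "v \<in> W"
      have "(\<Sum>k<m. eigenproj m h (l * z ^ k) v) \<in> span (\<Union>k<m. E (l * z ^ k))"
        using proj_E[OF v] by (intro span_sum span_base) auto
      then show "v \<in> span (\<Union>k<m. E (l * z ^ k))"
        by (simp add: sum_eigenproj[OF prim])
    qed
  qed
  show "has_dim W (m * n)" if "has_dim (eigenspace h l W) n"
  proof (subst span_E, rule has_dim_graded[where Q = "\<lambda>k. eigenproj m h (l * z ^ k)"])
    show "has_dim (E (l * z ^ k)) n" if "k < m" for k
      using that
    proof (induction k)
      case 0
      then show ?case
        using \<open>has_dim (eigenspace h l W) n\<close> by (simp add: E_def)
    next
      case (Suc k)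
      then show ?case
        using has_dim_image[of "E (l * z ^ k)" n u] bij[OF fk[of k]] lins by (simp add: mult_ac)
    qed
    show "lin (eigenproj m h (l * z ^ k))" for k
      by (rule lin_eigenproj[OF lins(1)])
    show "eigenproj m h (l * z ^ k) v = v" if "v \<in> E (l * z ^ k)" for k v
      using proj_of_E[OF that] lz0 by simp
    show "eigenproj m h (l * z ^ k) v = 0" if "k < m" "j < k" "v \<in> E (l * z ^ j)" for j k v
    proof -
      have "l * z ^ j \<noteq> l * z ^ k"
      proof
        assume "l * z ^ j = l * z ^ k"
        moreover have "z ^ k = z ^ j * z ^ (k - j)"
          using that(2) by (simp flip: power_add)
        ultimately have "z ^ j * z ^ (k - j) = z ^ j"
          using l by simp
        then show False
          using z0 zk[of "k - j"] that by simp
      qed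
      then show ?thesis
        using proj_of_E[OF that(3)] powlz lz0 by simp
    qed
  qed
  have E0: "E l \<noteq> {0}"
  proof
    assume "E l = {0}"
    then have "E (l * z ^ k) = {0}" if "k < m" for k
      using Ek[OF that] lin_0[OF lin_funpow[OF lins(2)]] by simp
    then have "(\<Union>k<m. E (l * z ^ k)) \<subseteq> {0}" by auto
    then have "W \<subseteq> {0}"
      using span_E span_minimal[OF _ subspace_single_0] by blast
    then show False
      using irreducible_onD(2)[OF irr] subspace_0[OF W] by blast
  qed
  have EU: "U = E l"
    if U: "subspace U" "U \<subseteq> E l" and gU: "\<And>g. g \<in> G \<Longrightarrow> g ` U \<subseteq> U" and U0: "U \<noteq> {0}" for U
  proof -
    \<comment> \<open>These vectors span the subspace generated by \<open>U\<close>. With powers of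
      both operators, stability is direct: \<open>w\<close> lowers a positive power of
      \<open>u\<close> up to a value of \<open>f\<close>, and conversely, while an exponent reaching
      \<open>m\<close> is absorbed by \<open>\<alpha>\<close> or \<open>\<beta>\<close>.\<close>
    define S where "S = {(t ^^ k) x | t k x. t \<in> {u, w} \<and> k < m \<and> x \<in> U}"
    have S: "(t ^^ k) x \<in> span S" if "t \<in> {u, w}" "k < m" "x \<in> U" for t k x
      using that by (intro span_base) (auto simp: S_def)
    have S_Suc: "t ((t ^^ k) x) \<in> span S" if "t \<in> {u, w}" "k < m" "x \<in> U" for t k x
    proof (cases "Suc k < m")
      case True
      then show ?thesis
        using S[OF that(1) True that(3)] by simp
    next
      case False
      then have "t ((t ^^ k) x) = (t ^^ m) x"
        using that(2) by (metis Suc_lessI funpow.simps(2) comp_apply)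
      also have "\<dots> \<in> span S"
        using that(1,3) upow wpow U(2) EW S[OF that(1) m that(3)] span_scale by fastforce
      finally show ?thesis .
    qed
    have x: "x \<in> E l" "x \<in> W" if "x \<in> U" for x
      using that U(2) EW by auto
    have stable: "t ` span S \<subseteq> span S" if t: "t \<in> insert h (insert u (insert w G))" for t
    proof (rule span_stable)
      show "lin t"
        using t lins by auto
      fix y assume "y \<in> S"
      then obtain s k x where y: "y = (s ^^ k) x" and s: "s \<in> {u, w}" and k: "k < m" "x \<in> U"
        by (auto simp: S_def)
      note xE = x[OF k(2)]
      consider "t = h" | "t = s" | "t \<in> {u, w}" "t \<noteq> s" | "t \<in> G"
        using t by blast
      then show "t y \<in> span S"
      proof cases
        case 1
        have "\<exists>c. h y = c \<cdot> y"
          using ukE[OF xE(1), of k] wkE[OF xE(1), of k] s by (auto simp: y E_def eigenspace_def)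
        then show ?thesis
          using S[OF s k] span_scale 1 y by metis
      next
        case 2
        then show ?thesis
          using S_Suc[OF s k] y by simp
      next
        case 3
        show ?thesis
        proof (cases k)
          case 0
          then show ?thesis
            using S_Suc[of t 0 x] 3 y k by simp
        next
          case (Suc j)
          have "\<exists>c. t (s ((s ^^ j) x)) = c \<cdot> (s ^^ j) x"
            using 3 s uw wu ukE[OF xE(1), of j] wkE[OF xE(1), of j] by (auto simp: E_def)
          then show ?thesis
            using S[OF s, of j x] k Suc y span_scale by (auto simp del: scale_left_commute)
        qed
      next
        case 4
        obtain c where "\<forall>v\<in>W. t (s v) = c \<cdot> s (t v)"
          using gu[OF 4] gw[OF 4] s by auto
        then have "t y = c ^ k \<cdot> (s ^^ k) (t x)"
          using funpow_commute[of s t W c x k] lins s stab xE 4 by (auto simp: y)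
        moreover have "t x \<in> U"
          using gU[OF 4] k by auto
        ultimately show ?thesis
          using S[OF s k(1)] span_scale by simp
      qed
    qed
    have US: "U \<subseteq> span S"
      using S[of u 0] m by auto
    have "S \<subseteq> W"
      using ukE wkE x EW by (fastforce simp: S_def)
    then have "span S = W"
      using irreducible_onD(5)[OF irr subspace_span _ stable] span_minimal[OF _ W] US U0
        subspace_0[OF U(1)] by (metis subset_singleton_iff equals0D)
    \<comment> \<open>For \<open>0 < k < m\<close> the vectors of \<open>S\<close> lie in
      eigenspaces other than \<open>E l\<close>, so the projection to \<open>E l\<close> kills them
      and only \<open>U\<close> survives. As \<open>span S\<close> is all of \<open>W\<close>, this
      puts \<open>E l\<close> inside \<open>U\<close>.\<close>
    moreover have "span S \<subseteq> {v. eigenproj m h l v \<in> U}"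
    proof (rule span_minimal)
      show "subspace {v. eigenproj m h l v \<in> U}"
        by (rule vp.linear_subspace_linear_preimage[OF lin_eigenproj[OF lins(1)] U(1)])
      show "S \<subseteq> {v. eigenproj m h l v \<in> U}"
      proof
        fix y assume "y \<in> S"
        then obtain s k x where y: "y = (s ^^ k) x" and s: "s \<in> {u, w}" and k: "k < m" "x \<in> U"
          by (auto simp: S_def)
        show "y \<in> {v. eigenproj m h l v \<in> U}"
        proof (cases "k = 0")
          case True
          then show ?thesis
            using proj_of_E[OF \<open>x \<in> U\<close>[THEN x(1)] refl l] k y by simp
        next
          case False
          have "y \<in> E (l * z ^ k) \<or> y \<in> E (l * inverse z ^ k)"
            using s ukE wkE x k y by auto
          moreover have "l * z ^ k \<noteq> l" "l * inverse z ^ k \<noteq> l"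
            using zk[of k] False k l by (simp_all add: power_inverse)
          ultimately have "eigenproj m h l y = 0"
            using proj_of_E[of y _ l] powlz l by metis
          then show ?thesis
            using subspace_0[OF U(1)] by simp
        qed
      qed
    qed
    ultimately show "U = E l"
      using proj_of_E[of _ l l] l EW U(2) by fastforce
  qed
  have gE: "g ` E l \<subseteq> E l" if "g \<in> G" for g
    using eigenspace_stable[OF lins(4)[OF that] stab(4)[OF that], of h] hg[OF that] by (simp add: E_def)
  have "U = {0} \<or> U = E l" if "subspace U \<and> U \<subseteq> E l \<and> (\<forall>g\<in>G. g ` U \<subseteq> U)" for U
    using EU[of U] that by auto
  then show "irreducible_on G (eigenspace h l W)"
    unfolding irreducible_on_def E_def[symmetric] using subE lins(4) gE E0 by simp
qed

lemma irreducible_scalar_dim: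
  assumes "irreducible_on G W" "\<And>g. g \<in> G \<Longrightarrow> \<exists>c. \<forall>v\<in>W. g v = c \<cdot> v"
  shows "has_dim W 1"
proof -
  obtain v where v: "v \<in> W" "v \<noteq> 0"
    using ex_nonzero irreducible_onD(1,2)[OF assms(1)] by blast
  have sub: "span {v} \<subseteq> W"
    using v irreducible_onD(1)[OF assms(1)] by (intro span_minimal) auto
  have "g ` span {v} \<subseteq> span {v}" if g: "g \<in> G" for g
  proof -
    obtain c where "\<forall>v\<in>W. g v = c \<cdot> v"
      using assms(2)[OF g] by blast
    then have "g x = c \<cdot> x" if "x \<in> span {v}" for x
      using that sub by blast
    then show ?thesis
      using span_scale by auto
  qed
  moreover have "span {v} \<noteq> {0}"
    using v(2) span_base[of v "{v}"] by blast
  ultimately have "span {v} = W"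
    using irreducible_onD(5)[OF assms(1) subspace_span sub] by blast
  then show ?thesis
    using has_dim_line[OF v(2)] by simp
qed

text \<open>Moving each \<open>u\<close> past each \<open>x\<close> costs a power of
  \<open>c\<close>. That the total factor is nonzero is what makes the \<open>m\<close>th power of
  the product an invertible scalar when those of \<open>x\<close> and \<open>u\<close> are.\<close>

lemma funpow_commuting_product:
  assumes lin: "lin x" "lin u" and c: "c \<noteq> 0" and comm: "\<And>v. u (x v) = c \<cdot> x (u v)"
  shows "\<exists>d. d \<noteq> 0 \<and> (\<forall>v. ((\<lambda>v. x ((u ^^ e) v)) ^^ n) v = d \<cdot> (x ^^ n) ((u ^^ (e * n)) v))"
proof (induction n)
  case 0
  show ?case by (intro exI[of _ 1]) simp
next
  case (Suc n)
  then obtain d where d: "d \<noteq> 0"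
    "\<And>v. ((\<lambda>v. x ((u ^^ e) v)) ^^ n) v = d \<cdot> (x ^^ n) ((u ^^ (e * n)) v)" by blast
  have "u ((x ^^ n) v) = c ^ n \<cdot> (x ^^ n) (u v)" for v
    by (rule funpow_commute[OF lin, where W = UNIV]) (use comm in auto)
  then have "(u ^^ e) ((x ^^ n) v) = (c ^ n) ^ e \<cdot> (x ^^ n) ((u ^^ e) v)" for v
    by (intro funpow_commute_left[OF lin_funpow[OF lin(1)] lin(2), where W = UNIV]) auto
  then have "((\<lambda>v. x ((u ^^ e) v)) ^^ Suc n) v
      = (d * (c ^ n) ^ e) \<cdot> (x ^^ Suc n) ((u ^^ (e * Suc n)) v)" for v
    by (simp add: d(2) lin_scale[OF lin(1)] lin_scale[OF lin_funpow[OF lin(2)]] funpow_add)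
  then show ?case
    using d(1) c by (intro exI[of _ "d * (c ^ n) ^ e"]) auto
qed

end

section \<open>Roots of unity\<close>

lemma primitive_root_power:
  assumes "primitive_root_of_unity m z" "coprime k m"
  shows "primitive_root_of_unity m (z ^ k)"
proof -
  have m: "m > 0" and z: "z ^ m = 1" and min: "\<And>j. 0 < j \<Longrightarrow> j < m \<Longrightarrow> z ^ j \<noteq> 1"
    using assms(1) by (auto simp: primitive_root_of_unity_def)
  have "(z ^ k) ^ j \<noteq> 1" if "0 < j" "j < m" for j
  proof
    assume "(z ^ k) ^ j = 1"
    then have "z ^ (k * j) = 1"
      by (simp add: power_mult)
    moreover have "z ^ (k * j) = z ^ ((k * j) mod m)"
      by (metis (no_types, lifting) mod_mult_div_eq power_add power_mult power_one z mult.right_neutral)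
    ultimately have "(k * j) mod m = 0"
      using min[of "(k * j) mod m"] m by (metis mod_less_divisor neq0_conv)
    then have "m dvd j"
      using assms(2) by (metis coprime_commute coprime_dvd_mult_right_iff dvd_eq_mod_eq_0)
    then show False
      using that by (simp add: nat_dvd_not_less)
  qed
  moreover have "(z ^ k) ^ m = 1"
    by (metis mult.commute power_mult power_one z)
  ultimately show ?thesis
    using m by (simp add: primitive_root_of_unity_def)
qed

lemma primitive_root_inverse:
  "primitive_root_of_unity m z \<Longrightarrow> primitive_root_of_unity m (inverse z)"
  by (auto simp: primitive_root_of_unity_def power_inverse)

text \<open>Both sides are monic of degree \<open>m\<close> with the \<open>m\<close> distinct zeros
  \<open>z ^ j\<close>, so their difference has more zeros than its degree allows unless it is
  0.\<close>

lemma prod_linear_factors_roots_of_unity: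
  assumes "primitive_root_of_unity m z"
  shows "(\<Prod>j<m. [:- (z ^ j), 1:]) = monom 1 m - 1"
proof -
  have m: "m > 0" and z: "z ^ m = 1" and min: "\<And>j. 0 < j \<Longrightarrow> j < m \<Longrightarrow> z ^ j \<noteq> 1"
    using assms by (auto simp: primitive_root_of_unity_def)
  have z0: "z \<noteq> 0"
    using z m by (auto simp: power_0_left)
  define p where "p = (\<Prod>j<m. [:- (z ^ j), 1:])"
  define r where "r = (monom 1 m - 1 :: complex poly)"
  have inj: "inj_on (\<lambda>j. z ^ j) {..<m}"
  proof (rule linorder_inj_onI')
    fix i j assume ij: "i \<in> {..<m}" "j \<in> {..<m}" "i < j"
    have "z ^ j = z ^ i * z ^ (j - i)"
      using ij by (simp flip: power_add)
    then show "z ^ i \<noteq> z ^ j"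
      using min[of "j - i"] ij z0 by auto
  qed
  have deg: "degree p = m"
    by (simp add: p_def degree_prod_eq_sum_degree)
  have lead: "coeff p m = 1"
    using lead_coeff_prod[of "\<lambda>j. [:- (z ^ j), 1:]" "{..<m}"] deg by (simp add: p_def)
  have degr: "degree r \<le> m" "coeff r m = 1"
    using m by (auto simp: r_def intro!: degree_diff_le degree_monom_le)
  have roots: "poly p (z ^ j) = 0" "poly r (z ^ j) = 0" if "j < m" for j
  proof -
    show "poly p (z ^ j) = 0"
      using that by (auto simp: p_def poly_prod)
    have "(z ^ j) ^ m = 1"
      by (metis mult.commute power_mult power_one z)
    then show "poly r (z ^ j) = 0"
      by (simp add: r_def poly_monom)
  qed
  have "p = r"
  proof (rule ccontr)
    assume "p \<noteq> r"
    then have ne: "p - r \<noteq> 0" by simp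
    have "coeff (p - r) m = 0"
      using lead degr by simp
    moreover have "degree (p - r) \<le> m"
      using deg degr by (intro degree_diff_le) simp_all
    ultimately have "degree (p - r) < m"
      using ne by (metis leading_coeff_0_iff le_neq_implies_less)
    moreover have "m \<le> card {x. poly (p - r) x = 0}"
    proof -
      have "(\<lambda>j. z ^ j) ` {..<m} \<subseteq> {x. poly (p - r) x = 0}"
        using roots by auto
      then have "card ((\<lambda>j. z ^ j) ` {..<m}) \<le> card {x. poly (p - r) x = 0}"
        by (rule card_mono[OF poly_roots_finite[OF ne]])
      then show ?thesis
        using card_image[OF inj] by simp
    qed
    ultimately show False
      using card_poly_roots_bound[OF ne] by simp
  qed
  then show ?thesis
    by (simp add: p_def r_def)
qed

section \<open>Representations of the algebra\<close>

lemma atLeast_eq_insert: "{b..} = insert b {b<..}" for b :: "'n::linorder"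
  by auto

locale oscillator_representation = complex_vector_space scale
  for scale :: "complex \<Rightarrow> 'v::ab_group_add \<Rightarrow> 'v" (infixr \<open>\<cdot>\<close> 75) +
  fixes q :: complex and m :: nat and Z Zs :: "'n::{finite,linorder} \<Rightarrow> 'v \<Rightarrow> 'v"
    and a as :: "'n \<Rightarrow> complex"
  assumes odd_m: "odd m" and prim: "primitive_root_of_unity m q"
    and lin_Z: "lin (Z i)" and lin_Zs: "lin (Zs i)"
    and Z_Z: "i < j \<Longrightarrow> Z i (Z j v) = inverse q \<cdot> Z j (Z i v)"
    and Zs_Zs: "i < j \<Longrightarrow> Zs i (Zs j v) = q \<cdot> Zs j (Zs i v)"
    and Z_Zs: "i \<noteq> j \<Longrightarrow> Z i (Zs j v) = inverse q \<cdot> Zs j (Z i v)"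
    and Z_Zs_same: "Z i (Zs i v) - Zs i (Z i v) = (q\<^sup>2 - 1) \<cdot> (\<Sum>k\<in>{k. i < k}. Z k (Zs k v))"
    and Z_pow: "(Z i ^^ m) v = a i \<cdot> v" and Zs_pow: "(Zs i ^^ m) v = as i \<cdot> v"
begin

lemma m_pos: "m > 0" and q_pow: "q ^ m = 1" and q_nonzero [simp]: "q \<noteq> 0"
  using prim by (auto simp: primitive_root_of_unity_def power_0_left)

section \<open>The generators and the elements \<Omega>\<close>

definition ops :: "'n set \<Rightarrow> ('v \<Rightarrow> 'v) set" where
  "ops A = Z ` A \<union> Zs ` A"

text \<open>For \<open>{b..}\<close> and \<open>{b<..}\<close> these are
  \<open>\<Omega>\<^sub>b\<close> and its successor; if \<open>b\<close> is the largest index, the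
  second set is empty and the successor is 0.\<close>

definition Om :: "'n set \<Rightarrow> 'v \<Rightarrow> 'v" where
  "Om A v = (\<Sum>k\<in>A. Z k (Zs k v))"

definition om :: "'n set \<Rightarrow> complex" where
  "om A = (\<Sum>k\<in>A. a k * as k)"

lemma lin_ops: "g \<in> ops A \<Longrightarrow> lin g"
  using lin_Z lin_Zs by (auto simp: ops_def)

lemma lin_Om: "lin (Om A)"
  unfolding Om_def by (intro lin_sum_ops lin_comp[of "Z _" "Zs _"] lin_Z lin_Zs)

lemma Om_empty [simp]: "Om {} v = 0"
  and Om_insert: "b \<notin> A \<Longrightarrow> Om (insert b A) v = Z b (Zs b v) + Om A v"
  by (simp_all add: Om_def)

lemma Om_atLeast: "Om {b..} v = Z b (Zs b v) + Om {b<..} v"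
  unfolding atLeast_eq_insert by (rule Om_insert) simp

text \<open>With \<open>Om_atLeast\<close> this gives
  \<open>Om {b..} v - q\<^sup>2 \<cdot> Om {b<..} v\<close>, so both products of the pair are linear
  combinations of the same two operators.\<close>

lemma Zs_Z_eq: "Zs b (Z b v) = Z b (Zs b v) - (q\<^sup>2 - 1) \<cdot> Om {b<..} v"
proof -
  have "{k. b < k} = {b<..}" by auto
  then show ?thesis
    using Z_Zs_same[of b v] by (simp add: Om_def algebra_simps)
qed

lemma Zs_Z: "i \<noteq> j \<Longrightarrow> Zs i (Z j v) = q \<cdot> Z j (Zs i v)"
  using Z_Zs[of j i v] by simp

lemma Z_Z': "i < j \<Longrightarrow> Z j (Z i v) = q \<cdot> Z i (Z j v)"
  and Zs_Zs': "i < j \<Longrightarrow> Zs j (Zs i v) = inverse q \<cdot> Zs i (Zs j v)"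
  using Z_Z[of i j v] Zs_Zs[of i j v] by simp_all

lemma Om_Z_below:
  assumes "\<forall>k\<in>A. i < k"
  shows "Om A (Z i v) = q\<^sup>2 \<cdot> Z i (Om A v)"
proof -
  have "Z k (Zs k (Z i v)) = q\<^sup>2 \<cdot> Z i (Z k (Zs k v))" if "k \<in> A" for k
  proof -
    have "i < k" "k \<noteq> i"
      using assms that by auto
    then show ?thesis
      by (simp add: Zs_Z[of k i] Z_Z'[of i k] lin_scale[OF lin_Z] power2_eq_square)
  qed
  then show ?thesis
    by (simp add: Om_def lin_sum[OF lin_Z] scale_sum_right)
qed

lemma Om_Zs_below:
  assumes "\<forall>k\<in>A. i < k"
  shows "Om A (Zs i v) = inverse (q\<^sup>2) \<cdot> Zs i (Om A v)"
proof -
  have "Z k (Zs k (Zs i v)) = inverse (q\<^sup>2) \<cdot> Zs i (Z k (Zs k v))" if "k \<in> A" for k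
  proof -
    have "i < k" "k \<noteq> i"
      using assms that by auto
    then show ?thesis
      by (simp add: Z_Zs[of k i] Zs_Zs'[of i k] lin_scale[OF lin_Z] power2_eq_square)
  qed
  then show ?thesis
    by (simp add: Om_def lin_sum[OF lin_Zs] scale_sum_right)
qed

text \<open>For a generator of larger index the factors from passing \<open>Zs b\<close> and
  \<open>Z b\<close> cancel. For \<open>Z b\<close> and \<open>Zs b\<close> themselves, the defect
  in their commutator is made up by the factor \<open>q\<^sup>2\<close> that they pick up from
  \<open>Om A\<close>.\<close>

lemma Om_commute:
  assumes "finite A" "\<And>i j. i \<in> A \<Longrightarrow> i < j \<Longrightarrow> j \<in> A" "g \<in> ops A"
  shows "Om A (g v) = g (Om A v)"
  using assms
proof (induction A arbitrary: g v rule: finite_linorder_min_induct)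
  case empty
  then show ?case by (simp add: ops_def)
next
  case (insert b A)
  have b: "b \<notin> A"
    using insert by auto
  have A: "A = {b<..}"
    using insert.hyps insert.prems(1)[of b] by auto
  have IH: "Om A (g v) = g (Om A v)" if "g \<in> ops A" for g v
    by (rule insert.IH[OF _ that]) (auto simp: A)
  consider j where "j \<in> A" "g = Z j" | j where "j \<in> A" "g = Zs j" | "g = Z b" | "g = Zs b"
    using insert.prems(2) by (auto simp: ops_def)
  then show ?case
  proof cases
    case 1
    then have "Om A (g v) = g (Om A v)"
      using IH[of g v] by (simp add: ops_def)
    moreover have "Z b (Zs b (Z j v)) = Z j (Z b (Zs b v))"
      using 1 by (auto simp: A Zs_Z Z_Z lin_scale[OF lin_Z])
    ultimately show ?thesis
      using 1 b by (simp add: Om_insert lin_add[OF lin_Z])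
  next
    case 2
    then have "Om A (g v) = g (Om A v)"
      using IH[of g v] by (simp add: ops_def)
    moreover have "Z b (Zs b (Zs j v)) = Zs j (Z b (Zs b v))"
      using 2 by (auto simp: A Z_Zs Zs_Zs lin_scale[OF lin_Z])
    ultimately show ?thesis
      using 2 b by (simp add: Om_insert lin_add[OF lin_Zs])
  next
    case 3
    have "Z b (Zs b (Z b v)) = Z b (Z b (Zs b v)) - (q\<^sup>2 - 1) \<cdot> Z b (Om A v)"
      by (simp add: Zs_Z_eq lin_diff[OF lin_Z] lin_scale[OF lin_Z] A)
    moreover have "Om A (Z b v) = q\<^sup>2 \<cdot> Z b (Om A v)"
      using insert.hyps by (intro Om_Z_below) auto
    ultimately show ?thesis
      using 3 b by (simp add: Om_insert lin_add[OF lin_Z] algebra_simps)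
  next
    case 4
    have "Z b (Zs b (Zs b v)) = Zs b (Z b (Zs b v)) + (q\<^sup>2 - 1) \<cdot> Om A (Zs b v)"
      by (simp add: Zs_Z_eq A)
    moreover have "Zs b (Om A v) = q\<^sup>2 \<cdot> Om A (Zs b v)"
      using Om_Zs_below[of A b v] insert.hyps by auto
    ultimately show ?thesis
      using 4 b by (simp add: Om_insert lin_add[OF lin_Zs] algebra_simps)
  qed
qed

lemma Om_commute_atLeast: "g \<in> ops {b..} \<Longrightarrow> Om {b..} (g v) = g (Om {b..} v)"
  and Om_commute_greaterThan: "g \<in> ops {b<..} \<Longrightarrow> Om {b<..} (g v) = g (Om {b<..} v)"
  by (rule Om_commute; auto)+

section \<open>The \<open>m\<close>th power of \<Omega>\<close>

text \<open>Write X for \<open>Om {b..}\<close> and Y for \<open>Om {b<..}\<close>. Then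
  \<open>Z b\<close> after \<open>Zs b\<close> is X - Y, and passing \<open>Zs b ^^ k\<close>
  multiplies Y by q^(-2k). So the left side is the product of the commuting factors X - q^(-2j) Y
  for j < k; \<open>c k\<close> is this product at Y = 1, made homogeneous again by the powers of
  Y.\<close>

lemma Z_Zs_power:
  defines "c k \<equiv> (\<Prod>j<k. [:- (inverse (q\<^sup>2) ^ j), 1:])"
  shows "(Z b ^^ k) ((Zs b ^^ k) v) =
    (\<Sum>i\<le>k. coeff (c k) i \<cdot> (Om {b..} ^^ i) ((Om {b<..} ^^ (k - i)) v))"
proof (induction k arbitrary: v)
  case 0
  then show ?case by (simp add: c_def)
next
  case (Suc k)
  let ?X = "Om {b..}" and ?Y = "Om {b<..}" and ?t = "inverse (q\<^sup>2) ^ k"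
  let ?M = "\<lambda>i j. (?X ^^ i) ((?Y ^^ j) v)"
  have XZs: "?X (Zs b v) = 1 \<cdot> Zs b (?X v)" for v
    using Om_commute_atLeast[of "Zs b" b v] by (simp add: ops_def)
  have XZsk: "?X ((Zs b ^^ k) v) = (Zs b ^^ k) (?X v)" for v
    using funpow_commute[OF lin_Zs lin_Om _ XZs, where W = UNIV] by simp
  have YZsk: "?Y ((Zs b ^^ k) v) = ?t \<cdot> (Zs b ^^ k) (?Y v)" for v
    by (rule funpow_commute[OF lin_Zs lin_Om, where W = UNIV]) (auto simp: Om_Zs_below)
  have X_Z: "?X (Z b v) = Z b (?X v)" and X_Zs: "?X (Zs b v) = Zs b (?X v)" for v
    by (rule Om_commute_atLeast; simp add: ops_def)+
  have Y_com: "?Y (Z b (Zs b v)) = Z b (Zs b (?Y v))" for v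
    by (simp add: Om_Z_below Om_Zs_below lin_scale[OF lin_Z])
  \<comment> \<open>\<open>?X\<close> is \<open>?Y\<close> plus \<open>Z b\<close> after
    \<open>Zs b\<close>, and \<open>?Y\<close> passes this product with factors
    \<open>q\<^sup>2\<close> and its inverse.\<close>
  have YX: "?Y (?X v) = 1 \<cdot> ?X (?Y v)" for v
    by (simp add: Om_atLeast lin_add[OF lin_Om] Y_com)
  have YXi: "(?Y ^^ j) (?X v) = ?X ((?Y ^^ j) v)" for j v
    using funpow_commute_left[OF lin_Om lin_Om _ YX, where W = UNIV] by simp
  have "(Z b ^^ Suc k) ((Zs b ^^ Suc k) v) = (Z b ^^ k) (Z b (Zs b ((Zs b ^^ k) v)))"
    by (simp add: funpow_swap1)
  also have "Z b (Zs b ((Zs b ^^ k) v)) = (Zs b ^^ k) (?X v) - ?t \<cdot> (Zs b ^^ k) (?Y v)"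
    using Om_atLeast[of b "(Zs b ^^ k) v"] XZsk YZsk by (simp add: algebra_simps)
  also have "(Z b ^^ k) \<dots> = (Z b ^^ k) ((Zs b ^^ k) (?X v)) - ?t \<cdot> (Z b ^^ k) ((Zs b ^^ k) (?Y v))"
    by (simp add: lin_diff[OF lin_funpow[OF lin_Z]] lin_scale[OF lin_funpow[OF lin_Z]])
  also have "\<dots> = (\<Sum>i\<le>k. coeff (c k) i \<cdot> ?M (Suc i) (k - i)) - ?t \<cdot> (\<Sum>i\<le>k. coeff (c k) i \<cdot> ?M i (Suc k - i))"
    unfolding Suc.IH by (simp add: YXi funpow_swap1 Suc_diff_le)
  also have "(\<Sum>i\<le>k. coeff (c k) i \<cdot> ?M (Suc i) (k - i)) = 
      (\<Sum>i\<le>Suc k. (if i = 0 then 0 else coeff (c k) (i - 1)) \<cdot> ?M i (Suc k - i))"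
    by (subst sum.atMost_Suc_shift) simp
  \<comment> \<open>The added index \<open>Suc k\<close> exceeds the degree of \<open>c k\<close>,
    so its coefficient is 0.\<close>
  also have "(\<Sum>i\<le>k. coeff (c k) i \<cdot> ?M i (Suc k - i)) = (\<Sum>i\<le>Suc k. coeff (c k) i \<cdot> ?M i (Suc k - i))"
  proof -
    have "degree (c k) \<le> k"
      unfolding c_def by (rule order_trans[OF degree_prod_sum_le]) auto
    then show ?thesis
      by (simp add: coeff_eq_0)
  qed
  also have "(\<Sum>i\<le>Suc k. (if i = 0 then 0 else coeff (c k) (i - 1)) \<cdot> ?M i (Suc k - i)) - ?t \<cdot> \<dots>
      = (\<Sum>i\<le>Suc k. coeff (c (Suc k)) i \<cdot> ?M i (Suc k - i))"
  proof -
    have "coeff (c (Suc k)) i = (if i = 0 then 0 else coeff (c k) (i - 1)) - ?t * coeff (c k) i" for i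
      by (cases i) (simp_all add: c_def mult.commute[of _ "[:_, 1:]"])
    then show ?thesis
      by (simp only: scale_sum_right sum_subtractf[symmetric] scale_left_diff_distrib scale_scale)
  qed
  finally show ?case .
qed

lemma primitive_q2: "primitive_root_of_unity m (q\<^sup>2)"
  using primitive_root_power[OF prim, of 2] odd_m by simp

text \<open>For \<open>k = m\<close> the numbers q^(-2j) run through all \<open>m\<close>th roots of
  unity, so the product of the factors collapses to the difference of the two \<open>m\<close>th
  powers.\<close>

lemma Om_pow_step: "(Om {b..} ^^ m) v = (a b * as b) \<cdot> v + (Om {b<..} ^^ m) v"
proof -
  let ?M = "\<lambda>i. (Om {b..} ^^ i) ((Om {b<..} ^^ (m - i)) v)"
  have "(a b * as b) \<cdot> v = (Z b ^^ m) ((Zs b ^^ m) v)"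
    by (simp add: Z_pow Zs_pow)
  also have "\<dots> = (\<Sum>i\<le>m. coeff (monom 1 m - 1) i \<cdot> ?M i)"
    unfolding Z_Zs_power
    using prod_linear_factors_roots_of_unity[OF primitive_root_inverse[OF primitive_q2]]
    by simp
  also have "\<dots> = (\<Sum>i\<le>m. (if i = m then ?M m else 0) - (if i = 0 then ?M 0 else 0))"
    using m_pos by (intro sum.cong refl) (auto simp: coeff_diff)
  also have "\<dots> = ?M m - ?M 0"
    by (simp add: sum_subtractf)
  finally show ?thesis
    by simp
qed

lemma Om_pow:
  assumes "finite A" "\<And>i j. i \<in> A \<Longrightarrow> i < j \<Longrightarrow> j \<in> A"
  shows "(Om A ^^ m) v = om A \<cdot> v"
  using assms
proof (induction A rule: finite_linorder_min_induct)
  case empty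
  then show ?case
    using m_pos by (cases m) (simp_all add: om_def)
next
  case (insert b A)
  have b: "b \<notin> A"
    using insert by auto
  have A: "A = {b<..}"
    using insert.hyps insert.prems[of b] by auto
  have "(Om {b<..} ^^ m) v = om {b<..} \<cdot> v"
    using insert.IH insert.hyps by (auto simp: A)
  then have "(Om {b..} ^^ m) v = om (insert b A) \<cdot> v"
    using b Om_pow_step[of b v] by (simp add: om_def A scale_left_distrib)
  then show ?case
    by (simp only: A atLeast_eq_insert)
qed

lemma Om_stable: "subspace U \<Longrightarrow> (\<And>g. g \<in> ops A \<Longrightarrow> g ` U \<subseteq> U) \<Longrightarrow> Om A ` U \<subseteq> U"
proof -
  assume U: "subspace U" "\<And>g. g \<in> ops A \<Longrightarrow> g ` U \<subseteq> U"
  have "Z k (Zs k v) \<in> U" if "k \<in> A" "v \<in> U" for k v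
    using U(2)[of "Z k"] U(2)[of "Zs k"] that by (auto simp: ops_def)
  then have "Om A v \<in> U" if "v \<in> U" for v
    unfolding Om_def using that by (intro subspace_sum[OF U(1)])
  then show ?thesis by blast
qed

lemma Om_pow_atLeast: "(Om {b..} ^^ m) v = om {b..} \<cdot> v"
  and Om_pow_greaterThan: "(Om {b<..} ^^ m) v = om {b<..} \<cdot> v"
  by (rule Om_pow; auto)+

lemma ops_atLeast: "ops {b..} = insert (Z b) (insert (Zs b) (ops {b<..}))"
  by (auto simp: ops_def atLeast_eq_insert)

lemma ops_Z_commute:
  assumes "g \<in> ops {b<..}"
  shows "\<exists>c. \<forall>v. g (Z b v) = c \<cdot> Z b (g v)" "\<exists>c. \<forall>v. g (Zs b v) = c \<cdot> Zs b (g v)"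
proof -
  consider j where "b < j" "g = Z j" | j where "b < j" "g = Zs j"
    using assms by (auto simp: ops_def)
  then show "\<exists>c. \<forall>v. g (Z b v) = c \<cdot> Z b (g v)"
    by cases (auto intro!: exI[of _ q] simp: Z_Z' Zs_Z)
  consider j where "b < j" "g = Z j" | j where "b < j" "g = Zs j"
    using assms by (auto simp: ops_def)
  then show "\<exists>c. \<forall>v. g (Zs b v) = c \<cdot> Zs b (g v)"
    by cases (auto intro!: exI[of _ "inverse q"] simp: Zs_Zs' Z_Zs)
qed

section \<open>Removing a pair when the next \<Omega> is invertible\<close>

lemma Om_scalar:
  assumes irr: "irreducible_on (ops {b..}) W"
  obtains \<mu> where "\<mu> ^ m = om {b..}" "\<And>v. v \<in> W \<Longrightarrow> Om {b..} v = \<mu> \<cdot> v"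
proof (rule central_scalar[OF irr lin_Om _ m_pos Om_pow_atLeast[of b] _ prim])
  show "Om {b..} ` W \<subseteq> W"
    using irreducible_onD(1,4)[OF irr] by (rule Om_stable)
qed (use that Om_commute_atLeast in auto)

lemma exists_root: "c \<noteq> 0 \<Longrightarrow> \<exists>l :: complex. l \<noteq> 0 \<and> l ^ m = c"
proof -
  assume c: "c \<noteq> 0"
  have "card {l :: complex. l ^ m = c} = m"
    by (rule card_nth_roots) (use c m_pos in auto)
  then have "{l :: complex. l ^ m = c} \<noteq> {}"
    using m_pos by (metis card.empty less_irrefl)
  then obtain l where "l ^ m = c" by blast
  then show ?thesis
    using c m_pos by (auto simp: power_0_left)
qed

text \<open>The rotated operator is \<open>Om {b<..}\<close>, with \<open>Z b\<close> and
  \<open>Zs b\<close> as forward and backward arrows. On its \<open>c\<close>-eigenspace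
  \<open>Z b\<close> after \<open>Zs b\<close> is the scalar \<open>\<mu> - c\<close>, where
  \<open>\<mu>\<close> is the value of the central \<open>Om {b..}\<close>, so at most one arrow of
  the cycle fails to be invertible.\<close>

lemma reduce_nonzero:
  assumes irr: "irreducible_on (ops {b..}) W" and om: "om {b<..} \<noteq> 0"
  obtains W' where "irreducible_on (ops {b<..}) W'" "\<And>n. has_dim W' n \<Longrightarrow> has_dim W (m * n)"
proof -
  let ?h = "Om {b<..}"
  note sub = irreducible_onD(1)[OF irr] and st = irreducible_onD(4)[OF irr]
  have hW: "?h ` W \<subseteq> W"
    using st by (intro Om_stable sub) (auto simp: ops_atLeast)
  obtain \<mu> where \<mu>: "\<mu> ^ m = om {b..}" "\<And>v. v \<in> W \<Longrightarrow> Om {b..} v = \<mu> \<cdot> v"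
    by (rule Om_scalar[OF irr]) blast
  \<comment> \<open>If \<open>\<mu>\<close> is a possible eigenvalue of \<open>Om {b<..}\<close>,
    the cycle is started there, so that \<open>\<mu> - c\<close> can vanish only on the closing
    arrow.\<close>
  obtain l where l: "l ^ m = om {b<..}" "\<mu> ^ m = om {b<..} \<longrightarrow> l = \<mu>"
    using exists_root[OF om] by (cases "\<mu> ^ m = om {b<..}") auto
  have l0: "l \<noteq> 0"
    using l(1) om m_pos by (auto simp: power_0_left)
  have q2: "(q\<^sup>2) ^ k \<noteq> 1" if "0 < k" "k < m" for k
    using primitive_q2 that unfolding primitive_root_of_unity_def by blast
  have ne: "\<mu> - l * (q\<^sup>2) ^ k \<noteq> 0" if "0 < k" "k < m" for k
  proof
    assume eq: "\<mu> - l * (q\<^sup>2) ^ k = 0"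
    have "((q\<^sup>2) ^ k) ^ m = 1"
      by (metis q_pow power_mult power_one mult.commute)
    then have "\<mu> ^ m = om {b<..}"
      using eq l(1) by (simp add: power_mult_distrib)
    with l(2) eq have "l * (q\<^sup>2) ^ k = l" by simp
    then show False
      using l0 q2[OF that] by simp
  qed
  have irr': "irreducible_on (insert ?h (insert (Z b) (insert (Zs b) (ops {b<..})))) W"
  proof (rule irreducible_on_change[OF irr])
    show "lin g \<and> g ` W \<subseteq> W" if "g \<in> insert ?h (insert (Z b) (insert (Zs b) (ops {b<..})))" for g
      using that hW st lin_Om lin_ops[of g "{b..}"] by (auto simp: ops_atLeast)
  qed (auto simp: ops_atLeast)
  have hu: "?h (Z b v) = q\<^sup>2 \<cdot> Z b (?h v)" and hw: "?h (Zs b v) = inverse (q\<^sup>2) \<cdot> Zs b (?h v)" for v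
    by (rule Om_Z_below Om_Zs_below; simp)+
  have uw: "Z b (Zs b v) = (\<mu> - c) \<cdot> v" if "v \<in> eigenspace ?h c W" for c v
    using that Om_atLeast[of b v] \<mu>(2)[of v] by (simp add: eigenspace_def algebra_simps)
  have wu: "Zs b (Z b v) = (\<mu> - c * q\<^sup>2) \<cdot> v" if "v \<in> eigenspace ?h c W" for c v
    using that uw[OF that] by (simp add: Zs_Z_eq eigenspace_def algebra_simps)
  have hpow: "(?h ^^ m) v = l ^ m \<cdot> v" for v
    by (simp add: Om_pow_greaterThan l(1))
  have gu: "\<exists>c. \<forall>v\<in>W. g (Z b v) = c \<cdot> Z b (g v)" "\<exists>c. \<forall>v\<in>W. g (Zs b v) = c \<cdot> Zs b (g v)"
    if "g \<in> ops {b<..}" for g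
    using ops_Z_commute[OF that] by blast+
  note cl = clock_reduction[OF primitive_q2 irr' l0 hpow hu hw Om_commute_greaterThan
      gu Z_pow Zs_pow uw wu ne]
  show ?thesis
    by (rule that[OF cl(1) cl(2)])
qed

text \<open>Since \<open>x ^^ m\<close> is an invertible scalar, \<open>y\<close> is determined on
  \<open>U\<close> by \<open>x\<close> and \<open>T\<close>: it is \<open>x ^^ (m - 1)\<close> after
  \<open>T\<close>, divided by \<open>\<xi>\<close>.\<close>

lemma partner_stable:
  assumes "lin x" "\<And>v. (x ^^ m) v = \<xi> \<cdot> v" "\<xi> \<noteq> 0" "\<And>v. v \<in> U \<Longrightarrow> x (y v) = T v"
    and U: "subspace U" "x ` U \<subseteq> U" "T ` U \<subseteq> U"
  shows "y ` U \<subseteq> U"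
proof -
  have "y v \<in> U" if "v \<in> U" for v
  proof -
    have "(x ^^ (m - 1)) (T v) = (x ^^ m) (y v)"
      using m_pos by (cases m) (simp_all add: assms(4)[OF that, symmetric] funpow_swap1)
    then have "y v = inverse \<xi> \<cdot> (x ^^ (m - 1)) (T v)"
      using assms(2,3) by simp
    moreover have "(x ^^ (m - 1)) (T v) \<in> U"
      using U that by (intro funpow_in) auto
    ultimately show ?thesis
      using subspace_scale[OF U(1)] by simp
  qed
  then show ?thesis by blast
qed

section \<open>Leftover operators, and the cases where \<Omega> vanishes\<close>

text \<open>One factor serves all generators with index in \<open>A\<close>, starred or not:
  \<open>inverse q\<close> if \<open>x\<close> comes from some \<open>Z b\<close>, and
  \<open>q\<close> if it comes from some \<open>Zs b\<close>. This uniformity lets two such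
  operators be combined into one that commutes with everything remaining.\<close>

definition grading :: "'n set \<Rightarrow> ('v \<Rightarrow> 'v) \<Rightarrow> complex \<Rightarrow> bool" where
  "grading A x \<kappa> \<longleftrightarrow> lin x \<and> \<kappa> \<in> {q, inverse q} \<and>
     (\<forall>g\<in>ops A. \<forall>v. x (g v) = \<kappa> \<cdot> g (x v))"

lemma grading_mono: "grading A x \<kappa> \<Longrightarrow> B \<subseteq> A \<Longrightarrow> grading B x \<kappa>"
  by (auto simp: grading_def ops_def)

lemma grading_nonzero: "grading A x \<kappa> \<Longrightarrow> \<kappa> \<noteq> 0"
  by (auto simp: grading_def)

lemma grading_Z: "grading {b<..} (Z b) (inverse q)"
  unfolding grading_def ops_def using lin_Z by (auto simp: Z_Z Z_Zs)

lemma grading_Zs: "grading {b<..} (Zs b) q"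
  unfolding grading_def ops_def using lin_Zs by (auto simp: Zs_Zs Zs_Z)

lemma grading_Om:
  assumes "grading A x \<kappa>"
  shows "Om A (x v) = inverse (\<kappa>\<^sup>2) \<cdot> x (Om A v)"
proof -
  have g: "g (x v) = inverse \<kappa> \<cdot> x (g v)" if "g \<in> ops A" for g v
    using assms that grading_nonzero[OF assms] by (auto simp: grading_def)
  have x: "lin x"
    using assms by (simp add: grading_def)
  have "Z k (Zs k (x v)) = inverse (\<kappa>\<^sup>2) \<cdot> x (Z k (Zs k v))" if "k \<in> A" for k
    using that by (simp add: g ops_def lin_scale[OF lin_Z] power2_eq_square)
  then show ?thesis
    by (simp add: Om_def lin_sum[OF x] scale_sum_right)
qed

text \<open>The operator is nilpotent because its \<open>m\<close>th power is
  \<open>om {b<..}\<close>, and it commutes up to scalars with all operators present, gradings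
  included. \<open>X\<close> will be empty or hold the single leftover.\<close>

lemma Om_zero:
  assumes irr: "irreducible_on (X \<union> ops {b..}) W" and X: "\<And>x. x \<in> X \<Longrightarrow> \<exists>\<kappa>. grading {b..} x \<kappa>"
    and om: "om {b<..} = 0" and v: "v \<in> W"
  shows "Om {b<..} v = 0"
proof (rule nilpotent_normal_zero[OF irr lin_Om _ _ _ v, of _ m])
  show "Om {b<..} ` W \<subseteq> W"
    using irreducible_onD(1,4)[OF irr] by (intro Om_stable) (auto simp: ops_atLeast)
  show "(Om {b<..} ^^ m) v = 0" for v
    by (simp add: Om_pow_greaterThan om)
  fix g assume "g \<in> X \<union> ops {b..}"
  then consider "g \<in> X" | "g = Z b" | "g = Zs b" | "g \<in> ops {b<..}"
    by (auto simp: ops_atLeast)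
  then show "\<exists>c. \<forall>v\<in>W. Om {b<..} (g v) = c \<cdot> g (Om {b<..} v)"
  proof cases
    case 1
    then obtain \<kappa> where "grading {b..} g \<kappa>"
      using X by blast
    then have "grading {b<..} g \<kappa>"
      by (rule grading_mono) auto
    then show ?thesis
      using grading_Om by blast
  next
    case 2
    then show ?thesis
      using Om_Z_below[of "{b<..}" b] by auto
  next
    case 3
    then show ?thesis
      using Om_Zs_below[of "{b<..}" b] by auto
  next
    case 4
    then show ?thesis
      using Om_commute_greaterThan by (intro exI[of _ 1]) simp
  qed
qed

lemma Z_Zs_commute_zero:
  assumes "Om {b<..} v = 0"
  shows "Z b (Zs b v) = Om {b..} v" "Zs b (Z b v) = Om {b..} v"
  using assms Om_atLeast[of b v] Zs_Z_eq[of b v] by simp_all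

text \<open>Both operators of the pair are nilpotent. The vanishing of \<open>Om {b<..}\<close> on
  \<open>W\<close> makes them commute with each other there, so \<open>nilpotent_normal_zero\<close>
  applies to each and the pair is dropped while \<open>W\<close> stays the same.\<close>

lemma reduce_trivial:
  assumes irr: "irreducible_on (X \<union> ops {b..}) W" and X: "\<And>x. x \<in> X \<Longrightarrow> \<exists>\<kappa>. grading {b..} x \<kappa>"
    and om: "om {b<..} = 0" and ab: "a b = 0" "as b = 0"
  shows "irreducible_on (X \<union> ops {b<..}) W"
proof -
  note Om0 = Om_zero[OF irr X om]
  have com: "Zs b (Z b v) = Z b (Zs b v)" if "v \<in> W" for v
    using Z_Zs_commute_zero[OF Om0[OF _ that]] by simp
  have bW: "Z b ` W \<subseteq> W" "Zs b ` W \<subseteq> W"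
    using irreducible_onD(4)[OF irr] by (auto simp: ops_atLeast)
  have comm: "\<exists>c. \<forall>v\<in>W. t (g v) = c \<cdot> g (t v)"
    if t: "t \<in> {Z b, Zs b}" and g: "g \<in> X \<union> ops {b..}" for t g
  proof -
    consider \<kappa> where "grading {b..} g \<kappa>" | "g \<in> {Z b, Zs b}" | "g \<in> ops {b<..}"
      using g X by (auto simp: ops_atLeast)
    then show ?thesis
    proof cases
      case 1
      have "t \<in> ops {b..}"
        using t by (auto simp: ops_def)
      then have "t (g v) = inverse \<kappa> \<cdot> g (t v)" for v
        using 1 grading_nonzero[OF 1] by (auto simp: grading_def)
      then show ?thesis by blast
    next
      case 2
      then show ?thesis
        using t com by (intro exI[of _ 1]) auto
    next
      case 3
      have "\<exists>c. \<forall>v. t (g v) = c \<cdot> g (t v)"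
        using t grading_Z[of b] grading_Zs[of b] 3 unfolding grading_def by blast
      then show ?thesis by blast
    qed
  qed
  have zero: "Z b v = 0" "Zs b v = 0" if v: "v \<in> W" for v
  proof -
    show "Z b v = 0"
      by (rule nilpotent_normal_zero[OF irr lin_Z bW(1) _ comm v, of m]) (simp_all add: Z_pow ab)
    show "Zs b v = 0"
      by (rule nilpotent_normal_zero[OF irr lin_Zs bW(2) _ comm v, of m]) (simp_all add: Zs_pow ab)
  qed
  show ?thesis
  proof (rule irreducible_on_change[OF irr])
    show "lin g \<and> g ` W \<subseteq> W" if "g \<in> X \<union> ops {b<..}" for g
      using that irreducible_onD(3,4)[OF irr, of g] by (auto simp: ops_atLeast)
  next
    fix U g
    assume U: "subspace U" "U \<subseteq> W" "\<And>g. g \<in> X \<union> ops {b<..} \<Longrightarrow> g ` U \<subseteq> U" and g: "g \<in> X \<union> ops {b..}"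
    show "g ` U \<subseteq> U"
    proof (cases "g \<in> {Z b, Zs b}")
      case True
      then show ?thesis
        using zero U(2) subspace_0[OF U(1)] by auto
    next
      case False
      then show ?thesis
        using g U(3)[of g] by (auto simp: ops_atLeast)
    qed
  qed
qed

lemma invertible_pair:
  assumes "a b \<noteq> 0 \<or> as b \<noteq> 0"
  obtains u y \<kappa> \<alpha> where "grading {b<..} u \<kappa>" "\<And>v. (u ^^ m) v = \<alpha> \<cdot> v" "\<alpha> \<noteq> 0"
    "(u = Z b \<and> y = Zs b) \<or> (u = Zs b \<and> y = Z b)"
proof (cases "a b = 0")
  case True
  then show ?thesis
    using that[OF grading_Zs Zs_pow] assms by blast
next
  case False
  then show ?thesis
    using that[OF grading_Z Z_pow] by blast
qed

text \<open>As \<open>Om {b<..}\<close> vanishes on \<open>W\<close>, the product of the pair is the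
  scalar value of the central \<open>Om {b..}\<close>. Hence the partner of the invertible member
  \<open>u\<close> is recovered from \<open>u\<close>, which alone is kept.\<close>

lemma reduce_to_graded:
  assumes irr: "irreducible_on (ops {b..}) W" and om: "om {b<..} = 0" and ab: "a b \<noteq> 0 \<or> as b \<noteq> 0"
  obtains x \<kappa> \<xi> where "grading {b<..} x \<kappa>" "\<And>v. (x ^^ m) v = \<xi> \<cdot> v" "\<xi> \<noteq> 0"
    "irreducible_on (insert x (ops {b<..})) W"
proof -
  obtain u y \<kappa> \<alpha> where u: "grading {b<..} u \<kappa>" "\<And>v. (u ^^ m) v = \<alpha> \<cdot> v" "\<alpha> \<noteq> 0"
    and uy: "(u = Z b \<and> y = Zs b) \<or> (u = Zs b \<and> y = Z b)"
    by (rule invertible_pair[OF ab]) blast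
  note sub = irreducible_onD(1)[OF irr] and st = irreducible_onD(4)[OF irr]
  obtain \<mu> where \<mu>: "\<mu> ^ m = om {b..}" "\<And>v. v \<in> W \<Longrightarrow> Om {b..} v = \<mu> \<cdot> v"
    by (rule Om_scalar[OF irr]) blast
  have Om0: "Om {b<..} v = 0" if "v \<in> W" for v
    using Om_zero[of "{}" b W v] irr om that by simp
  have uyW: "u (y v) = \<mu> \<cdot> v" if "v \<in> W" for v
    using uy Z_Zs_commute_zero[OF Om0[OF that]] \<mu>(2)[OF that] by auto
  have linu: "lin u"
    using u(1) by (simp add: grading_def)
  have "irreducible_on (insert u (ops {b<..})) W"
  proof (rule irreducible_on_change[OF irr])
    show "lin g \<and> g ` W \<subseteq> W" if "g \<in> insert u (ops {b<..})" for g
      using that uy st[of g] lin_ops[of g "{b..}"] by (auto simp: ops_atLeast)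
  next
    fix U g
    assume U: "subspace U" "U \<subseteq> W" "\<And>g. g \<in> insert u (ops {b<..}) \<Longrightarrow> g ` U \<subseteq> U"
      and g: "g \<in> ops {b..}"
    have "y ` U \<subseteq> U"
    proof (rule partner_stable[OF linu u(2,3)])
      show "u (y v) = \<mu> \<cdot> v" if "v \<in> U" for v
        using uyW U(2) that by blast
      show "(\<lambda>v. \<mu> \<cdot> v) ` U \<subseteq> U"
        using subspace_scale[OF U(1)] by auto
    qed (use U(1) U(3)[of u] in auto)
    then show "g ` U \<subseteq> U"
      using g U(3)[of g] U(3)[of u] uy by (auto simp: ops_atLeast)
  qed
  then show ?thesis
    using that u by blast
qed

text \<open>The leftover \<open>x\<close> and an invertible member \<open>u\<close> of the new pair
  both scale the generators of larger index, so a product of \<open>x\<close> with a power of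
  \<open>u\<close> commutes with these; it still commutes with \<open>u\<close> only up to
  \<open>\<kappa>\<close>, and \<open>u\<close> rotates its eigenspaces. The partner of
  \<open>u\<close> is recovered from \<open>u\<close> and \<open>Om {b<..}\<close> because
  \<open>Om {b..}\<close> vanishes on \<open>W\<close>. No leftover remains on
  \<open>W'\<close>.\<close>

lemma reduce_graded:
  assumes irr: "irreducible_on (insert x (ops {b..})) W" and gx: "grading {b..} x \<kappa>"
    and xpow: "\<And>v. (x ^^ m) v = \<xi> \<cdot> v" and \<xi>: "\<xi> \<noteq> 0"
    and om: "om {b..} = 0" and ab: "a b \<noteq> 0 \<or> as b \<noteq> 0"
  obtains W' where "irreducible_on (ops {b<..}) W'" "\<And>n. has_dim W' n \<Longrightarrow> has_dim W (m * n)"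
proof -
  obtain u y \<kappa>' \<alpha> where u: "grading {b<..} u \<kappa>'" "\<And>v. (u ^^ m) v = \<alpha> \<cdot> v" "\<alpha> \<noteq> 0"
    and uy: "(u = Z b \<and> y = Zs b) \<or> (u = Zs b \<and> y = Z b)"
    by (rule invertible_pair[OF ab]) blast
  note sub = irreducible_onD(1)[OF irr] and st = irreducible_onD(4)[OF irr]
  have linx: "lin x" and linu: "lin u"
    using gx u(1) by (auto simp: grading_def)
  have \<kappa>: "\<kappa> \<in> {q, inverse q}" "\<kappa>' \<in> {q, inverse q}"
    using gx u(1) by (auto simp: grading_def)
  have \<kappa>0: "\<kappa> \<noteq> 0"
    by (rule grading_nonzero[OF gx])
  have prim\<kappa>: "primitive_root_of_unity m \<kappa>"
    using \<kappa>(1) prim primitive_root_inverse by blast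
  have \<kappa>pow: "\<kappa> ^ m = 1"
    using prim\<kappa> by (simp add: primitive_root_of_unity_def)
  have \<kappa>pred: "\<kappa> * \<kappa> ^ (m - 1) = 1"
    using \<kappa>pow m_pos by (cases m) auto
  \<comment> \<open>The exponent is 1 if the two factors are inverse to each other, and
    \<open>m - 1\<close>, that is -1 modulo \<open>m\<close>, if they agree.\<close>
  obtain e where e: "\<kappa> * \<kappa>' ^ e = 1"
  proof (cases "\<kappa> * \<kappa>' = 1")
    case True
    then show ?thesis
      using that[of 1] by simp
  next
    case False
    then have "\<kappa> = \<kappa>'"
      using \<kappa> by auto
    then show ?thesis
      using that[of "m - 1"] \<kappa>pred by simp
  qed
  have xu: "x (u v) = \<kappa> \<cdot> u (x v)" for v
    using gx uy by (auto simp: grading_def ops_def)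
  then have ux: "u (x v) = inverse \<kappa> \<cdot> x (u v)" for v
    using \<kappa>0 by simp
  define h where "h = (\<lambda>v. x ((u ^^ e) v))"
  \<comment> \<open>The backward arrow is the inverse of \<open>u\<close> up to the nonzero scalar
    \<open>\<alpha>\<close>. Here \<open>f\<close> is the constant \<open>\<alpha>\<close>, so every
    arrow is invertible.\<close>
  define w where "w = u ^^ (m - 1)"
  have linh: "lin h"
    unfolding h_def by (rule lin_comp[OF linx lin_funpow[OF linu]])
  have linw: "lin w"
    unfolding w_def by (intro lin_funpow linu)
  have uW: "u ` W \<subseteq> W" and xW: "x ` W \<subseteq> W"
    using uy st by (auto simp: ops_atLeast)
  have hW: "h ` W \<subseteq> W"
    using xW funpow_in[OF uW] by (auto simp: h_def)
  have wW: "w ` W \<subseteq> W"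
    using funpow_in[OF uW] by (auto simp: w_def)
  have um: "u ^^ m = u \<circ> w" "u ^^ m = w \<circ> u"
    using m_pos funpow_Suc_right[of "m - 1" u] by (cases m; simp add: w_def)+
  have uw_eq: "u (w v) = \<alpha> \<cdot> v" and wu_eq: "w (u v) = \<alpha> \<cdot> v" for v
    using u(2)[of v] um by (metis comp_apply)+
  have hu: "h (u v) = \<kappa> \<cdot> u (h v)" for v
    by (simp add: h_def funpow_swap1[symmetric] xu)
  have "h (w v) = \<kappa> ^ (m - 1) \<cdot> w (h v)" for v
    unfolding w_def by (rule funpow_commute[OF linu linh, where W = UNIV]) (use hu in auto)
  moreover have "\<kappa> ^ (m - 1) = inverse \<kappa>"
    using \<kappa>pred by (metis inverse_unique)
  ultimately have hw: "h (w v) = inverse \<kappa> \<cdot> w (h v)" for v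
    by simp
  have hg: "h (g v) = g (h v)" if g: "g \<in> ops {b<..}" for g v
  proof -
    have "(u ^^ e) (g v) = \<kappa>' ^ e \<cdot> g ((u ^^ e) v)"
      by (rule funpow_commute_left[OF lin_ops[OF g] linu, where W = UNIV])
        (use u(1) g in \<open>auto simp: grading_def\<close>)
    moreover have "x (g v) = \<kappa> \<cdot> g (x v)" for v
      using gx g by (auto simp: grading_def ops_atLeast)
    ultimately show ?thesis
      using e by (simp add: h_def lin_scale[OF linx] mult.commute)
  qed
  obtain d where d: "d \<noteq> 0" "\<And>v. (h ^^ m) v = d \<cdot> (x ^^ m) ((u ^^ (e * m)) v)"
    unfolding h_def using funpow_commuting_product[OF linx linu _ ux, where e = e and n = m] \<kappa>0 by auto
  have uem: "(u ^^ (e * m)) v = \<alpha> ^ e \<cdot> v" for v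
    using funpow_eigen[OF lin_funpow[OF linu] u(2), of e v]
    by (simp add: funpow_mult mult.commute)
  have "d * \<xi> * \<alpha> ^ e \<noteq> 0"
    using d(1) \<xi> u(3) by simp
  then obtain l where l: "l ^ m = d * \<xi> * \<alpha> ^ e" and l0: "l \<noteq> 0"
    using exists_root by blast
  have hpow: "(h ^^ m) v = l ^ m \<cdot> v" for v
    by (simp add: d(2) uem xpow l lin_scale[OF lin_funpow[OF linx]] mult_ac)
  have Om0: "Om {b..} v = 0" if v: "v \<in> W" for v
  proof (rule nilpotent_normal_zero[OF irr lin_Om _ _ _ v, of _ m])
    show "Om {b..} ` W \<subseteq> W"
      using st by (intro Om_stable sub) auto
    show "(Om {b..} ^^ m) v = 0" for v
      by (simp add: Om_pow_atLeast om)
    fix g assume "g \<in> insert x (ops {b..})"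
    then consider "g = x" | "g \<in> ops {b..}" by blast
    then show "\<exists>c. \<forall>v\<in>W. Om {b..} (g v) = c \<cdot> g (Om {b..} v)"
    proof cases
      case 1
      then show ?thesis
        using grading_Om[OF gx] by blast
    next
      case 2
      then show ?thesis
        using Om_commute_atLeast by (intro exI[of _ 1]) simp
    qed
  qed
  \<comment> \<open>The constant is -1 for \<open>u = Z b\<close> and \<open>- (q\<^sup>2)\<close>
    for \<open>u = Zs b\<close>.\<close>
  obtain t where t: "\<And>v. v \<in> W \<Longrightarrow> u (y v) = t \<cdot> Om {b<..} v"
  proof -
    have ZZ: "Z b (Zs b v) = (- 1) \<cdot> Om {b<..} v" if "v \<in> W" for v
      using Om0[OF that] Om_atLeast[of b v] by (simp add: eq_neg_iff_add_eq_0)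
    have ZZ': "Zs b (Z b v) = (- (q\<^sup>2)) \<cdot> Om {b<..} v" if "v \<in> W" for v
      using ZZ[OF that] by (simp add: Zs_Z_eq algebra_simps)
    show ?thesis
      using uy that[of "- 1"] that[of "- (q\<^sup>2)"] ZZ ZZ' by blast
  qed
  have irr': "irreducible_on (insert h (insert u (insert w (ops {b<..})))) W"
  proof (rule irreducible_on_change[OF irr])
    show "lin g \<and> g ` W \<subseteq> W" if "g \<in> insert h (insert u (insert w (ops {b<..})))" for g
      using that linh linu linw hW uW wW st[of g] lin_ops[of g "{b..}"] by (auto simp: ops_atLeast)
  next
    fix U g
    assume U: "subspace U" "U \<subseteq> W"
      "\<And>g. g \<in> insert h (insert u (insert w (ops {b<..}))) \<Longrightarrow> g ` U \<subseteq> U"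
      and g: "g \<in> insert x (ops {b..})"
    have hU: "h ` U \<subseteq> U" and uU: "u ` U \<subseteq> U" and oU: "\<And>g. g \<in> ops {b<..} \<Longrightarrow> g ` U \<subseteq> U"
      using U(3) by simp_all
    have xU: "x v \<in> U" if "v \<in> U" for v
    proof -
      \<comment> \<open>\<open>x\<close> is recovered from \<open>h\<close> by completing
        \<open>u ^^ e\<close> to \<open>u ^^ (e * m)\<close>, a nonzero scalar.\<close>
      have "h ((u ^^ (e * m - e)) v) = x ((u ^^ (e + (e * m - e))) v)"
        by (simp add: h_def funpow_add)
      also have "e + (e * m - e) = e * m"
        using m_pos by simp
      finally have "x v = inverse (\<alpha> ^ e) \<cdot> h ((u ^^ (e * m - e)) v)"
        using u(3) by (simp add: uem lin_scale[OF linx])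
      moreover have "h ((u ^^ (e * m - e)) v) \<in> U"
        using hU funpow_in[OF uU that] by blast
      ultimately show ?thesis
        using subspace_scale[OF U(1)] by simp
    qed
    have "y ` U \<subseteq> U"
    proof (rule partner_stable[OF linu u(2,3)])
      show "u (y v) = t \<cdot> Om {b<..} v" if "v \<in> U" for v
        using t U(2) that by blast
      show "(\<lambda>v. t \<cdot> Om {b<..} v) ` U \<subseteq> U"
        using Om_stable[OF U(1) oU] subspace_scale[OF U(1)] by auto
    qed (use U(1) uU in auto)
    then show "g ` U \<subseteq> U"
      using g xU uU oU[of g] uy by (auto simp: ops_atLeast)
  qed
  have gu: "\<exists>c. \<forall>v\<in>W. g (u v) = c \<cdot> u (g v)" if "g \<in> ops {b<..}" for g
    using ops_Z_commute[OF that] uy by blast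
  have gw: "\<exists>c. \<forall>v\<in>W. g (w v) = c \<cdot> w (g v)" if g: "g \<in> ops {b<..}" for g
  proof -
    obtain c where c: "\<forall>v\<in>W. g (u v) = c \<cdot> u (g v)"
      using gu[OF g] by blast
    have "g (w v) = c ^ (m - 1) \<cdot> w (g v)" if "v \<in> W" for v
      unfolding w_def by (rule funpow_commute[OF linu lin_ops[OF g] uW _ that]) (use c in auto)
    then show ?thesis by blast
  qed
  have wpow: "(w ^^ m) v = \<alpha> ^ (m - 1) \<cdot> v" for v
  proof -
    have "(w ^^ m) v = ((u ^^ m) ^^ (m - 1)) v"
      by (simp add: w_def funpow_mult mult.commute)
    also have "\<dots> = \<alpha> ^ (m - 1) \<cdot> v"
      by (rule funpow_eigen[OF lin_funpow[OF linu] u(2)])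
    finally show ?thesis .
  qed
  note cl = clock_reduction[OF prim\<kappa> irr' l0 hpow hu hw hg gu gw u(2) wpow uw_eq wu_eq u(3)]
  show ?thesis
    by (rule that[OF cl(1) cl(2)])
qed

end

section \<open>The radical of the Poisson bivector\<close>

lemma vec_linearI:
  fixes f :: "complex ^ 'k \<Rightarrow> complex ^ 'l"
  assumes "\<And>x y. f (x + y) = f x + f y" "\<And>c x. f (c *s x) = c *s f x"
  shows "Vector_Spaces.linear (*s) (*s) f"
  unfolding Vector_Spaces.linear_iff by (intro conjI allI vec.vector_space_axioms assms)

lemma vec_dim_kernel_functional:
  fixes S :: "(complex ^ 'k::finite) set"
  assumes S: "vec.subspace S" and \<phi>: "\<And>x y. \<phi> (x + y) = \<phi> x + \<phi> y" "\<And>c x. \<phi> (c *s x) = c * \<phi> x"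
    and v: "v \<in> S" "\<phi> v = (1::complex)"
  shows "vec.dim S = vec.dim {w \<in> S. \<phi> w = 0} + 1"
proof -
  let ?K = "{w \<in> S. \<phi> w = 0}"
  have \<phi>0: "\<phi> 0 = 0"
    using \<phi>(2)[of 0 0] by simp
  have K: "vec.subspace ?K"
    using S \<phi> \<phi>0 by (auto simp: vec.subspace_def)
  have "v \<notin> vec.span ?K"
    using K v by (simp add: vec.span_eq_iff[THEN iffD2])
  then have "vec.dim (insert v ?K) = vec.dim ?K + 1"
    by (simp add: vec.dim_insert)
  moreover have "vec.span (insert v ?K) = S"
  proof
    show "vec.span (insert v ?K) \<subseteq> S"
      using S v by (intro vec.span_minimal) auto
    show "S \<subseteq> vec.span (insert v ?K)"
    proof
      fix w assume w: "w \<in> S"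
      have "\<phi> (w + (- \<phi> w) *s v) = 0"
        using \<phi> v by (simp only: \<phi>) simp
      moreover have "w + (- \<phi> w) *s v \<in> S"
        using S w v by (intro vec.subspace_add vec.subspace_scale)
      ultimately have "w + (- \<phi> w) *s v \<in> vec.span (insert v ?K)"
        by (intro vec.span_base) auto
      moreover have "\<phi> w *s v \<in> vec.span (insert v ?K)"
        by (intro vec.span_scale vec.span_base) auto
      ultimately have "(w + (- \<phi> w) *s v) + \<phi> w *s v \<in> vec.span (insert v ?K)"
        by (rule vec.span_add)
      then show "w \<in> vec.span (insert v ?K)"
        by (simp add: vec.scale_minus_left)
    qed
  qed
  ultimately show ?thesis
    by (metis vec.dim_span)
qed

lemma vec_dim_image:
  fixes f :: "complex ^ 'k::finite \<Rightarrow> complex ^ 'l::finite"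
  assumes "vec.subspace S" "Vector_Spaces.linear (*s) (*s) f" "inj_on f S"
  shows "vec.dim (f ` S) = vec.dim S"
  using assms by (intro vec.dim_image_eq) (simp_all add: vec.span_eq_iff[THEN iffD2])

text \<open>A linear right inverse on the range of \<open>f\<close> embeds that range as a
  complement of the kernel.\<close>

lemma vec_rank_nullity:
  fixes f :: "complex ^ 'k::finite \<Rightarrow> complex ^ 'l::finite"
  assumes f: "Vector_Spaces.linear (*s) (*s) f"
  shows "vec.dim (range f) + vec.dim {w. f w = 0} = CARD('k)"
proof -
  obtain g where g: "Vector_Spaces.linear (*s) (*s) g" "\<And>v. v \<in> range f \<Longrightarrow> f (g v) = v"
    using vec.linear_exists_right_inverse_on[OF f vec.subspace_UNIV] by blast
  let ?K = "{w. f w = 0}" and ?T = "g ` range f"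
  have K: "vec.subspace ?K"
    by (rule vec.linear_subspace_kernel[OF f])
  have R: "vec.subspace (range f)"
    by (rule vec.linear_subspace_image[OF f vec.subspace_UNIV])
  have T: "vec.subspace ?T"
    by (rule vec.linear_subspace_image[OF g(1) R])
  have dT: "vec.dim ?T = vec.dim (range f)"
    by (rule vec_dim_image[OF R g(1)]) (metis g(2) inj_on_inverseI)
  have "?K \<inter> ?T = {0}"
  proof
    show "?K \<inter> ?T \<subseteq> {0}"
      using g(2) vec.linear_0[OF g(1)] by force
    show "{0} \<subseteq> ?K \<inter> ?T"
      using vec.subspace_0[OF K] vec.subspace_0[OF T] by simp
  qed
  moreover have "{x + y |x y. x \<in> ?K \<and> y \<in> ?T} = UNIV"
  proof -
    have "w = (w - g (f w)) + g (f w)" "f (w - g (f w)) = 0" for w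
      using g(2) by (simp_all add: vec.linear_diff[OF f])
    then show ?thesis by blast
  qed
  ultimately show ?thesis
    using vec.dim_sums_Int[OF K T] dT by (simp add: vec_dim_card del: vec.dim_UNIV)
qed

section \<open>The bivector at a point, restricted to a set of indices\<close>

locale poisson_point =
  fixes a :: "complex ^ ('n::{finite,linorder} + 'n)"
begin

definition omega :: "'n set \<Rightarrow> complex" where
  "omega I = (\<Sum>k\<in>I. a $ Inl k * a $ Inr k)"

text \<open>The covector \<open>w\<close> evaluated on the Euler vector field at \<open>a\<close>,
  restricted to the indices in \<open>I\<close>.\<close>

definition euler :: "'n set \<Rightarrow> complex ^ ('n + 'n) \<Rightarrow> complex" where
  "euler I w = (\<Sum>j\<in>I. w $ Inl j * a $ Inl j + w $ Inr j * a $ Inr j)"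

definition contract :: "'n set \<Rightarrow> complex ^ ('n + 'n) \<Rightarrow> 'n + 'n \<Rightarrow> complex" where
  "contract I w c = (\<Sum>j\<in>I. w $ Inl j * coord_bracket (Inl j) c a + w $ Inr j * coord_bracket (Inr j) c a)"

text \<open>The kernel of the restricted bivector. Covectors are extended by zero, so that radicals
  for different \<open>I\<close> lie in one space and are related by linear maps.\<close>

definition radical :: "'n set \<Rightarrow> (complex ^ ('n + 'n)) set" where
  "radical I = {w. (\<forall>j. j \<notin> I \<longrightarrow> w $ Inl j = 0 \<and> w $ Inr j = 0) \<and>
     (\<forall>j\<in>I. contract I w (Inl j) = 0 \<and> contract I w (Inr j) = 0)}"

text \<open>The radical of the bivector bordered by one additional coordinate \<open>x\<close> with
  \<open>{x, a\<^sub>j} = x a\<^sub>j\<close> and \<open>{x, a\<^sub>j\<^sup>*} = x a\<^sub>j\<^sup>*\<close>; the component along \<open>dx / x\<close> is stored at the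
  otherwise unused index \<open>Inl p\<close>.\<close>

definition graded_radical :: "'n \<Rightarrow> 'n set \<Rightarrow> (complex ^ ('n + 'n)) set" where
  "graded_radical p I = {w. (\<forall>j. j \<notin> I \<longrightarrow> (j \<noteq> p \<longrightarrow> w $ Inl j = 0) \<and> w $ Inr j = 0) \<and>
     (\<forall>j\<in>I. contract I w (Inl j) + w $ Inl p * a $ Inl j = 0 \<and>
             contract I w (Inr j) + w $ Inl p * a $ Inr j = 0) \<and>
     euler I w = 0}"

lemma contract_add: "contract I (v + w) c = contract I v c + contract I w c"
  and contract_scale: "contract I (t *s v) c = t * contract I v c"
  and euler_add: "euler I (v + w) = euler I v + euler I w"
  and euler_scale: "euler I (t *s v) = t * euler I v"
  by (simp_all add: contract_def euler_def sum.distrib[symmetric] sum_distrib_left algebra_simps)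

lemma contract_0: "contract I 0 c = 0" and euler_0: "euler I 0 = 0"
  by (simp_all add: contract_def euler_def)

lemma subspace_radical: "vec.subspace (radical I)"
  unfolding vec.subspace_def radical_def by (auto simp: contract_add contract_scale contract_0)

lemma subspace_graded_radical: "vec.subspace (graded_radical p I)"
  unfolding vec.subspace_def graded_radical_def
proof (intro conjI ballI allI CollectI; clarsimp simp: contract_add contract_scale contract_0
    euler_add euler_scale euler_0)
qed (auto simp: algebra_simps add_eq_0_iff)

lemma cong_contract:
  assumes "\<And>j. j \<in> I \<Longrightarrow> v $ Inl j = w $ Inl j" "\<And>j. j \<in> I \<Longrightarrow> v $ Inr j = w $ Inr j"
  shows "contract I v c = contract I w c" "euler I v = euler I w"
  using assms by (auto simp: contract_def euler_def intro!: sum.cong)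

lemma axis_nth_sum:
  "axis (Inl b) t $ Inl j = (if j = b then t else 0)" "axis (Inl b) t $ Inr j = 0"
  "axis (Inr b) t $ Inr j = (if j = b then t else 0)" "axis (Inr b) t $ Inl j = 0"
  by (simp_all add: axis_def)

lemma contract_axis:
  assumes "b \<notin> I"
  shows "contract I (axis (Inl b) t) c = 0" "contract I (axis (Inr b) t) c = 0"
    "euler I (axis (Inl b) t) = 0" "euler I (axis (Inr b) t) = 0"
  using assms by (auto simp: contract_def euler_def axis_def intro!: sum.neutral)

lemma greaterThan_Collect: "{k. b < k} = {b<..}" for b :: 'n
  by auto

lemma omega_atLeast: "omega {b..} = a $ Inl b * a $ Inr b + omega {b<..}"
  unfolding atLeast_eq_insert omega_def by simp

lemma euler_atLeast: "euler {b..} w = w $ Inl b * a $ Inl b + w $ Inr b * a $ Inr b + euler {b<..} w"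
  unfolding atLeast_eq_insert euler_def by simp

text \<open>The source of the recursion. In the equations of larger index the pair at
  \<open>b\<close> enters only through one number times the coordinate, which is exactly how the
  bordering component enters \<open>graded_radical\<close>. In the equations of index
  \<open>b\<close> the larger indices enter only through \<open>euler\<close> and
  \<open>omega\<close>.\<close>

lemma contract_atLeast:
  shows "b < j \<Longrightarrow> contract {b..} w (Inl j) =
      contract {b<..} w (Inl j) + (w $ Inr b * a $ Inr b - w $ Inl b * a $ Inl b) * a $ Inl j"
    and "b < j \<Longrightarrow> contract {b..} w (Inr j) =
      contract {b<..} w (Inr j) + (w $ Inr b * a $ Inr b - w $ Inl b * a $ Inl b) * a $ Inr j"
    and "contract {b..} w (Inl b) = a $ Inl b * euler {b<..} w - 2 * omega {b<..} * w $ Inr b"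
    and "contract {b..} w (Inr b) = 2 * omega {b<..} * w $ Inl b - a $ Inr b * euler {b<..} w"
proof -
  have split: "contract {b..} w c = w $ Inl b * coord_bracket (Inl b) c a
      + w $ Inr b * coord_bracket (Inr b) c a + contract {b<..} w c" for c
    unfolding atLeast_eq_insert contract_def by simp
  show "b < j \<Longrightarrow> contract {b..} w (Inl j) =
      contract {b<..} w (Inl j) + (w $ Inr b * a $ Inr b - w $ Inl b * a $ Inl b) * a $ Inl j"
    by (simp add: split algebra_simps)
  show "b < j \<Longrightarrow> contract {b..} w (Inr j) =
      contract {b<..} w (Inr j) + (w $ Inr b * a $ Inr b - w $ Inl b * a $ Inl b) * a $ Inr j"
    by (simp add: split algebra_simps)
  have "contract {b<..} w (Inl b) = a $ Inl b * euler {b<..} w"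
    unfolding contract_def euler_def sum_distrib_left
    by (intro sum.cong) (auto simp: algebra_simps)
  then show "contract {b..} w (Inl b) = a $ Inl b * euler {b<..} w - 2 * omega {b<..} * w $ Inr b"
    by (simp add: split omega_def greaterThan_Collect)
  have "contract {b<..} w (Inr b) = - (a $ Inr b * euler {b<..} w)"
    unfolding contract_def euler_def sum_distrib_left sum_negf[symmetric]
    by (intro sum.cong) (auto simp: algebra_simps)
  then show "contract {b..} w (Inr b) = 2 * omega {b<..} * w $ Inl b - a $ Inr b * euler {b<..} w"
    by (simp add: split omega_def greaterThan_Collect)
qed

text \<open>The differential of \<open>omega I\<close> lies in the radical.\<close>

lemma omega_casimir:
  assumes "finite I" "\<And>i j. i \<in> I \<Longrightarrow> i < j \<Longrightarrow> j \<in> I"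
  shows "(\<Sum>j\<in>I. a $ Inr j * contract I w (Inl j) + a $ Inl j * contract I w (Inr j)) = 0"
  using assms
proof (induction I rule: finite_linorder_min_induct)
  case empty
  then show ?case by simp
next
  case (insert b A)
  have A: "A = {b<..}"
    using insert.hyps insert.prems[of b] by auto
  let ?k = "w $ Inr b * a $ Inr b - w $ Inl b * a $ Inl b"
  have IH: "(\<Sum>j\<in>A. a $ Inr j * contract A w (Inl j) + a $ Inl j * contract A w (Inr j)) = 0"
    by (rule insert.IH) (auto simp: A)
  have "(\<Sum>j\<in>A. a $ Inr j * contract {b..} w (Inl j) + a $ Inl j * contract {b..} w (Inr j))
      = (\<Sum>j\<in>A. (a $ Inr j * contract A w (Inl j) + a $ Inl j * contract A w (Inr j))
          + 2 * ?k * (a $ Inl j * a $ Inr j))"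
    by (intro sum.cong refl) (auto simp: A contract_atLeast algebra_simps)
  also have "\<dots> = (\<Sum>j\<in>A. a $ Inr j * contract A w (Inl j) + a $ Inl j * contract A w (Inr j))
      + (\<Sum>j\<in>A. 2 * ?k * (a $ Inl j * a $ Inr j))"
    by (rule sum.distrib)
  also have "\<dots> = 2 * ?k * omega A"
    by (simp only: IH omega_def sum_distrib_left[symmetric]) simp
  \<comment> \<open>The summands of index \<open>b\<close> add up to
    \<open>- 2 * ?k * omega A\<close>, since their \<open>euler\<close> terms cancel.\<close>
  finally show ?case
    unfolding A atLeast_eq_insert[symmetric]
    by (subst atLeast_eq_insert) (simp add: contract_atLeast algebra_simps)
qed

section \<open>Change of the radical when the smallest index is removed\<close>

text \<open>The Casimir \<open>omega {b<..}\<close> forces the contribution of the pair to the other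
  equations to vanish, and the two equations of index \<open>b\<close> can be solved for the pair.
  So an element of the larger radical is determined by its restriction, which is arbitrary in the
  smaller one.\<close>

lemma dim_radical_nonzero:
  assumes om: "omega {b<..} \<noteq> 0"
  shows "vec.dim (radical {b..}) = vec.dim (radical {b<..})"
proof -
  let ?A = "{b<..}" and ?o = "2 * omega {b<..}"
  \<comment> \<open>The added components solve the two equations of index \<open>b\<close>.\<close>
  define f where "f w = w + (a $ Inr b * euler ?A w / ?o) *s axis (Inl b) 1
    + (a $ Inl b * euler ?A w / ?o) *s axis (Inr b) 1" for w
  have fl: "f w $ Inl b = w $ Inl b + a $ Inr b * euler ?A w / ?o"
    "f w $ Inr b = w $ Inr b + a $ Inl b * euler ?A w / ?o"
    "j \<noteq> b \<Longrightarrow> f w $ Inl j = w $ Inl j" "j \<noteq> b \<Longrightarrow> f w $ Inr j = w $ Inr j" for w j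
    by (simp_all add: f_def axis_def)
  have lin: "Vector_Spaces.linear (*s) (*s) f"
    by (rule vec_linearI)
      (simp_all add: f_def vec_eq_iff euler_add euler_scale add_divide_distrib algebra_simps)
  have Af: "contract ?A (f w) c = contract ?A w c" "euler ?A (f w) = euler ?A w" for w c
    by (rule cong_contract; simp add: fl)+
  have b0: "w $ Inl b = 0" "w $ Inr b = 0" if "w \<in> radical ?A" for w
    using that by (auto simp: radical_def)
  have inj: "inj_on f (radical ?A)"
  proof (rule inj_onI)
    fix v w assume vw: "v \<in> radical ?A" "w \<in> radical ?A" "f v = f w"
    have "v $ c = w $ c" for c
    proof (cases c)
      case (Inl j)
      then show ?thesis
        using fl(3)[of j v] fl(3)[of j w] vw b0 by (cases "j = b") auto
    next
      case (Inr j)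
      then show ?thesis
        using fl(4)[of j v] fl(4)[of j w] vw b0 by (cases "j = b") auto
    qed
    then show "v = w"
      by (simp add: vec_eq_iff)
  qed
  have "f ` radical ?A = radical {b..}"
  proof
    show "f ` radical ?A \<subseteq> radical {b..}"
    proof clarify
      fix w assume w: "w \<in> radical ?A"
      have "f w $ Inr b * a $ Inr b - f w $ Inl b * a $ Inl b = 0"
        using b0[OF w] by (simp add: fl)
      then have "contract {b..} (f w) (Inl j) = 0 \<and> contract {b..} (f w) (Inr j) = 0" if "b \<le> j" for j
        using that w om b0[OF w]
        by (cases "j = b") (auto simp: contract_atLeast Af fl radical_def field_simps)
      moreover have "f w $ Inl j = 0 \<and> f w $ Inr j = 0" if "j \<notin> {b..}" for j
        using w that by (auto simp: fl radical_def)
      ultimately show "f w \<in> radical {b..}"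
        by (auto simp: radical_def)
    qed
    show "radical {b..} \<subseteq> f ` radical ?A"
    proof
      fix w assume w: "w \<in> radical {b..}"
      define k where "k = w $ Inr b * a $ Inr b - w $ Inl b * a $ Inl b"
      have cA: "contract ?A w (Inl j) = - k * a $ Inl j" "contract ?A w (Inr j) = - k * a $ Inr j"
        if "b < j" for j
        using w that contract_atLeast(1,2)[OF that, of w, folded k_def]
        by (auto simp: radical_def eq_neg_iff_add_eq_0)
      \<comment> \<open>Pairing with the differential of \<open>omega ?A\<close> isolates
        \<open>k\<close>.\<close>
      have "0 = (\<Sum>j\<in>?A. a $ Inr j * contract ?A w (Inl j) + a $ Inl j * contract ?A w (Inr j))"
        by (rule omega_casimir[symmetric]) auto
      also have "\<dots> = (\<Sum>j\<in>?A. (- 2 * k) * (a $ Inl j * a $ Inr j))"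
        by (intro sum.cong refl) (auto simp: cA algebra_simps)
      also have "\<dots> = (- 2 * k) * omega ?A"
        by (simp only: omega_def sum_distrib_left)
      finally have k0: "k = 0"
        using om by auto
      have eqs: "w $ Inl b = a $ Inr b * euler ?A w / ?o" "w $ Inr b = a $ Inl b * euler ?A w / ?o"
        using w om contract_atLeast(3,4)[of b w] by (auto simp: radical_def field_simps)
      define w' where "w' = w - w $ Inl b *s axis (Inl b) 1 - w $ Inr b *s axis (Inr b) 1"
      have w'l: "w' $ Inl b = 0" "w' $ Inr b = 0"
        "j \<noteq> b \<Longrightarrow> w' $ Inl j = w $ Inl j" "j \<noteq> b \<Longrightarrow> w' $ Inr j = w $ Inr j" for j
        by (simp_all add: w'_def axis_def)
      have Aw': "contract ?A w' c = contract ?A w c" "euler ?A w' = euler ?A w" for c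
        by (rule cong_contract; simp add: w'l)+
      have "w' \<in> radical ?A"
        unfolding radical_def
      proof (intro CollectI conjI allI ballI impI)
        show "w' $ Inl j = 0" "w' $ Inr j = 0" if "j \<notin> ?A" for j
          using that w w'l by (cases "j = b"; auto simp: radical_def)+
        show "contract ?A w' (Inl j) = 0" "contract ?A w' (Inr j) = 0" if "j \<in> ?A" for j
          using that cA k0 by (simp_all add: Aw')
      qed
      moreover have "w = f w'"
        by (simp add: f_def Aw' eqs[symmetric]) (simp add: w'_def)
      ultimately show "w \<in> f ` radical ?A" by blast
    qed
  qed
  then show ?thesis
    using vec_dim_image[OF subspace_radical lin inj] by simp
qed

text \<open>All brackets with the two coordinates of index \<open>b\<close> vanish at the point, so
  their differentials span a free plane in the radical.\<close>

lemma dim_radical_trivial: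
  assumes om: "omega {b<..} = 0" and ab: "a $ Inl b = 0" "a $ Inr b = 0"
  shows "vec.dim (radical {b..}) = vec.dim (radical {b<..}) + 2"
proof -
  let ?S = "radical {b..}"
  let ?S1 = "{w \<in> ?S. w $ Inl b = 0}"
  let ?S2 = "{w \<in> ?S1. w $ Inr b = 0}"
  have e: "axis (Inl b) 1 \<in> ?S" "axis (Inr b) 1 \<in> ?S1"
    using om ab by (auto simp: radical_def axis_nth_sum le_less contract_atLeast contract_axis)
  have "?S2 = radical {b<..}"
  proof (intro equalityI subsetI)
    fix w assume w: "w \<in> ?S2"
    have "w $ Inl j = 0 \<and> w $ Inr j = 0" if "j \<notin> {b<..}" for j
      using w that by (cases "j = b") (auto simp: radical_def)
    moreover have "contract {b<..} w (Inl j) = 0 \<and> contract {b<..} w (Inr j) = 0" if "b < j" for j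
      using w contract_atLeast(1,2)[OF that, of w] that by (auto simp: radical_def ab)
    ultimately show "w \<in> radical {b<..}"
      by (simp add: radical_def)
  next
    fix w assume "w \<in> radical {b<..}"
    then show "w \<in> ?S2"
      by (auto simp: radical_def contract_atLeast le_less ab om)
  qed
  moreover have "vec.dim ?S = vec.dim ?S1 + 1"
    by (rule vec_dim_kernel_functional[OF subspace_radical _ _ e(1)]) auto
  moreover have "vec.subspace ?S1"
    using subspace_radical[of "{b..}"] by (auto simp: vec.subspace_def)
  then have "vec.dim ?S1 = vec.dim ?S2 + 1"
    by (rule vec_dim_kernel_functional[OF _ _ _ e(2)]) auto
  ultimately show ?thesis by simp
qed

lemma dim_graded_radical_trivial:
  assumes om: "omega {b<..} = 0" and ab: "a $ Inl b = 0" "a $ Inr b = 0" and p: "p < b"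
  shows "vec.dim (graded_radical p {b..}) = vec.dim (graded_radical p {b<..}) + 2"
proof -
  let ?S = "graded_radical p {b..}"
  let ?S1 = "{w \<in> ?S. w $ Inl b = 0}"
  let ?S2 = "{w \<in> ?S1. w $ Inr b = 0}"
  have e: "axis (Inl b) 1 \<in> ?S" "axis (Inr b) 1 \<in> ?S1"
    using om ab p
    by (auto simp: graded_radical_def axis_nth_sum le_less contract_atLeast euler_atLeast contract_axis)
  have "?S2 = graded_radical p {b<..}"
  proof (intro equalityI subsetI)
    fix w assume w: "w \<in> ?S2"
    have "(j \<noteq> p \<longrightarrow> w $ Inl j = 0) \<and> w $ Inr j = 0" if "j \<notin> {b<..}" for j
      using w that by (cases "j = b") (auto simp: graded_radical_def)
    moreover have "contract {b<..} w (Inl j) + w $ Inl p * a $ Inl j = 0 \<and>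
        contract {b<..} w (Inr j) + w $ Inl p * a $ Inr j = 0" if "b < j" for j
    proof -
      have "contract {b..} w (Inl j) + w $ Inl p * a $ Inl j = 0 \<and>
          contract {b..} w (Inr j) + w $ Inl p * a $ Inr j = 0"
        using w that by (simp add: graded_radical_def)
      then show ?thesis
        by (simp add: contract_atLeast(1,2)[OF that] ab)
    qed
    moreover have "euler {b<..} w = 0"
      using w by (auto simp: graded_radical_def euler_atLeast ab)
    ultimately show "w \<in> graded_radical p {b<..}"
      by (simp add: graded_radical_def)
  next
    fix w assume "w \<in> graded_radical p {b<..}"
    then show "w \<in> ?S2"
      using p by (auto simp: graded_radical_def contract_atLeast euler_atLeast le_less ab om)
  qed
  moreover have "vec.dim ?S = vec.dim ?S1 + 1"
    by (rule vec_dim_kernel_functional[OF subspace_graded_radical _ _ e(1)]) auto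
  moreover have "vec.subspace ?S1"
    using subspace_graded_radical[of p "{b..}"] by (auto simp: vec.subspace_def)
  then have "vec.dim ?S1 = vec.dim ?S2 + 1"
    by (rule vec_dim_kernel_functional[OF _ _ _ e(2)]) auto
  ultimately show ?thesis by simp
qed

lemma bezout_pair:
  assumes "x \<noteq> 0 \<or> y \<noteq> (0::complex)"
  obtains r s where "r * x + s * y = 1"
  using assms that[of "inverse x" 0] that[of 0 "inverse y"] by fastforce

text \<open>With \<open>omega {b<..} = 0\<close> the equations of index \<open>b\<close> say that
  \<open>euler {b<..} w = 0\<close>, and the others see the pair only through one number. The pair
  thus acts as a single bordering coordinate; the direction in which that number is 0 accounts for
  the \<open>+ 1\<close>.\<close>

lemma dim_radical_graded:
  assumes om: "omega {b<..} = 0" and ab: "a $ Inl b \<noteq> 0 \<or> a $ Inr b \<noteq> 0"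
  shows "vec.dim (radical {b..}) = vec.dim (graded_radical b {b<..}) + 1"
proof -
  let ?A = "{b<..}"
  obtain r s where rs: "r * a $ Inl b + s * a $ Inr b = 1"
    by (rule bezout_pair[OF ab])
  \<comment> \<open>\<open>?v\<close> spans the covectors on the pair that do not affect the larger
    indices. Through \<open>rs\<close>, \<open>\<phi>\<close> takes the value 1 on it, so the kernel
    of \<open>\<phi>\<close> is a complement.\<close>
  define \<phi> where "\<phi> w = r * w $ Inr b + s * w $ Inl b" for w :: "complex ^ ('n + 'n)"
  let ?v = "axis (Inl b) (a $ Inr b) + axis (Inr b) (a $ Inl b)"
  let ?K = "{w \<in> radical {b..}. \<phi> w = 0}"
  have v: "?v \<in> radical {b..}" "\<phi> ?v = 1"
    using om rs
    by (auto simp: radical_def \<phi>_def axis_nth_sum le_less contract_atLeast contract_axis contract_add euler_add)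
  have dim: "vec.dim (radical {b..}) = vec.dim ?K + 1"
    by (rule vec_dim_kernel_functional[where v = "?v"])
      (rule subspace_radical v | simp add: \<phi>_def algebra_simps)+
  \<comment> \<open>The stored component is spread over the pair with coefficients
    \<open>- r\<close> and \<open>s\<close>: by \<open>rs\<close> this reproduces its effect on the
    larger indices, and it lies in the kernel of \<open>\<phi>\<close>. The \<open>- 1\<close>
    removes the stored copy.\<close>
  define f where "f w = w + ((- r - 1) * w $ Inl b) *s axis (Inl b) 1 + (s * w $ Inl b) *s axis (Inr b) 1"
    for w :: "complex ^ ('n + 'n)"
  have fl: "f w $ Inl b = - r * w $ Inl b" "f w $ Inr b = w $ Inr b + s * w $ Inl b"
    "j \<noteq> b \<Longrightarrow> f w $ Inl j = w $ Inl j" "j \<noteq> b \<Longrightarrow> f w $ Inr j = w $ Inr j" for w j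
    by (simp_all add: f_def axis_def algebra_simps)
  have lin: "Vector_Spaces.linear (*s) (*s) f"
    by (rule vec_linearI) (simp_all add: f_def vec_eq_iff algebra_simps)
  have Af: "contract ?A (f w) c = contract ?A w c" "euler ?A (f w) = euler ?A w" for w c
    by (rule cong_contract; simp add: fl)+
  have b0: "w $ Inr b = 0" if "w \<in> graded_radical b ?A" for w
    using that by (auto simp: graded_radical_def)
  have kap: "f w $ Inr b * a $ Inr b - f w $ Inl b * a $ Inl b = w $ Inl b"
    if "w \<in> graded_radical b ?A" for w
  proof -
    have "f w $ Inr b * a $ Inr b - f w $ Inl b * a $ Inl b = (r * a $ Inl b + s * a $ Inr b) * w $ Inl b"
      using b0[OF that] by (simp add: fl algebra_simps)
    then show ?thesis
      using rs by simp
  qed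
  have inj: "inj_on f (graded_radical b ?A)"
  proof (rule inj_onI)
    fix v w assume vw: "v \<in> graded_radical b ?A" "w \<in> graded_radical b ?A" "f v = f w"
    have "v $ c = w $ c" for c
    proof (cases c)
      case (Inl j)
      then show ?thesis
        using fl(3)[of j v] fl(3)[of j w] vw kap[of v] kap[of w] by (cases "j = b") auto
    next
      case (Inr j)
      then show ?thesis
        using fl(4)[of j v] fl(4)[of j w] vw b0 by (cases "j = b") auto
    qed
    then show "v = w"
      by (simp add: vec_eq_iff)
  qed
  have "f ` graded_radical b ?A = ?K"
  proof
    show "f ` graded_radical b ?A \<subseteq> ?K"
    proof clarify
      fix w assume w: "w \<in> graded_radical b ?A"
      have "contract {b..} (f w) (Inl j) = 0 \<and> contract {b..} (f w) (Inr j) = 0" if "b \<le> j" for j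
        using that w om
        by (cases "j = b") (auto simp: contract_atLeast Af kap[OF w] graded_radical_def)
      moreover have "f w $ Inl j = 0 \<and> f w $ Inr j = 0" if "j \<notin> {b..}" for j
        using w that by (auto simp: fl graded_radical_def)
      moreover have "\<phi> (f w) = 0"
        using b0[OF w] by (simp add: \<phi>_def fl)
      ultimately show "f w \<in> radical {b..} \<and> \<phi> (f w) = 0"
        by (auto simp: radical_def)
    qed
    show "?K \<subseteq> f ` graded_radical b ?A"
    proof
      fix w assume wK: "w \<in> ?K"
      then have w: "w \<in> radical {b..}" and \<phi>w: "r * w $ Inr b = - (s * w $ Inl b)"
        by (auto simp: \<phi>_def eq_neg_iff_add_eq_0)
      define k where "k = w $ Inr b * a $ Inr b - w $ Inl b * a $ Inl b"
      have cA: "contract ?A w (Inl j) + k * a $ Inl j = 0" "contract ?A w (Inr j) + k * a $ Inr j = 0"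
        if "b < j" for j
        using w that contract_atLeast(1,2)[OF that, of w] by (auto simp: radical_def k_def)
      have "a $ Inl b * euler ?A w = 0" "a $ Inr b * euler ?A w = 0"
        using w om contract_atLeast(3,4)[of b w] by (auto simp: radical_def)
      with ab have eu: "euler ?A w = 0" by auto
      have wl: "w $ Inl b = - r * k"
      proof -
        have "- r * k = r * a $ Inl b * w $ Inl b - (r * w $ Inr b) * a $ Inr b"
          by (simp add: k_def algebra_simps)
        also have "\<dots> = (r * a $ Inl b + s * a $ Inr b) * w $ Inl b"
          by (simp only: \<phi>w) (simp add: algebra_simps)
        finally show ?thesis
          using rs by simp
      qed
      have wr: "w $ Inr b = s * k"
      proof -
        have "s * k = s * a $ Inr b * w $ Inr b - (s * w $ Inl b) * a $ Inl b"
          by (simp add: k_def algebra_simps)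
        also have "s * w $ Inl b = - (r * w $ Inr b)"
          by (simp add: \<phi>w)
        also have "s * a $ Inr b * w $ Inr b - (- (r * w $ Inr b)) * a $ Inl b
            = (r * a $ Inl b + s * a $ Inr b) * w $ Inr b"
          by (simp add: algebra_simps)
        finally show ?thesis
          using rs by simp
      qed
      define w' where "w' = w + (k - w $ Inl b) *s axis (Inl b) 1 - w $ Inr b *s axis (Inr b) 1"
      have w'l: "w' $ Inl b = k" "w' $ Inr b = 0"
        "j \<noteq> b \<Longrightarrow> w' $ Inl j = w $ Inl j" "j \<noteq> b \<Longrightarrow> w' $ Inr j = w $ Inr j" for j
        by (simp_all add: w'_def axis_def)
      have Aw': "contract ?A w' c = contract ?A w c" "euler ?A w' = euler ?A w" for c
        by (rule cong_contract; simp add: w'l)+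
      have "w' \<in> graded_radical b ?A"
        unfolding graded_radical_def
      proof (intro CollectI conjI allI ballI impI)
        show "w' $ Inl j = 0" if "j \<notin> ?A" "j \<noteq> b" for j
          using that w w'l by (auto simp: radical_def)
        show "w' $ Inr j = 0" if "j \<notin> ?A" for j
          using that w w'l by (cases "j = b") (auto simp: radical_def)
        show "contract ?A w' (Inl j) + w' $ Inl b * a $ Inl j = 0"
          "contract ?A w' (Inr j) + w' $ Inl b * a $ Inr j = 0" if "j \<in> ?A" for j
          using that cA by (simp_all add: Aw' w'l)
        show "euler ?A w' = 0"
          by (simp add: Aw' eu)
      qed
      moreover have "f w' = w"
      proof -
        have "f w' $ c = w $ c" for c
        proof (cases c)
          case (Inl j)
          then show ?thesis
            using wl by (cases "j = b") (simp_all add: fl w'l)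
        next
          case (Inr j)
          then show ?thesis
            using wr by (cases "j = b") (simp_all add: fl w'l)
        qed
        then show ?thesis
          by (simp add: vec_eq_iff)
      qed
      ultimately show "w \<in> f ` graded_radical b ?A" by blast
    qed
  qed
  then show ?thesis
    using vec_dim_image[OF subspace_graded_radical lin inj] dim by simp
qed

text \<open>Here \<open>omega {b<..}\<close> is minus the product of the coordinates of the pair.
  Given the \<open>euler\<close> condition, both equations of index \<open>b\<close> become
  multiples of the joint contribution of pair and border to the larger indices, which must therefore
  be 0. The three components of pair and border satisfy this condition and the \<open>euler\<close>
  condition, which leaves one free direction besides the smaller radical.\<close>

lemma dim_graded_radical:
  assumes om: "omega {b..} = 0" and ab: "a $ Inl b \<noteq> 0 \<or> a $ Inr b \<noteq> 0" and p: "p < b"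
  shows "vec.dim (graded_radical p {b..}) = vec.dim (radical {b<..}) + 1"
proof -
  let ?A = "{b<..}" and ?x = "a $ Inl b" and ?y = "a $ Inr b"
  have omA: "omega ?A = - (?x * ?y)"
    using om omega_atLeast[of b] by (simp add: eq_neg_iff_add_eq_0 add.commute)
  obtain r s where rs: "r * ?x + s * ?y = 1"
    by (rule bezout_pair[OF ab])
  define \<phi> where "\<phi> w = s * w $ Inl b - r * w $ Inr b" for w :: "complex ^ ('n + 'n)"
  \<comment> \<open>The homogeneous solution: the pair contributes 0 to \<open>euler\<close>, and
    the border cancels its effect \<open>- 2 * ?x * ?y\<close> on the larger indices.\<close>
  let ?v = "axis (Inl b) ?y + axis (Inr b) (- ?x) + axis (Inl p) (2 * ?x * ?y)"
  let ?K = "{w \<in> graded_radical p {b..}. \<phi> w = 0}"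
  have pb: "p \<noteq> b" "b \<noteq> p" "p \<notin> ?A" "\<not> b \<le> p"
    using p by auto
  have pA: "j \<noteq> b" "j \<noteq> p" if "j \<in> ?A" for j
    using that p by auto
  have v: "?v \<in> graded_radical p {b..}" "\<phi> ?v = 1"
  proof -
    show "\<phi> ?v = 1"
      using rs pb by (simp add: \<phi>_def axis_nth_sum algebra_simps)
    show "?v \<in> graded_radical p {b..}"
      using pb by (auto simp: graded_radical_def axis_nth_sum le_less contract_atLeast euler_atLeast
          contract_axis contract_add euler_add omA algebra_simps)
  qed
  have dim: "vec.dim (graded_radical p {b..}) = vec.dim ?K + 1"
    by (rule vec_dim_kernel_functional[where v = "?v"])
      (rule subspace_graded_radical v | simp add: \<phi>_def algebra_simps)+
  \<comment> \<open>The particular solution for the given \<open>euler ?A w\<close>, normalised to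
    lie in the kernel of \<open>\<phi>\<close>.\<close>
  define f where "f w = w + (- r * euler ?A w) *s axis (Inl b) 1 + (- s * euler ?A w) *s axis (Inr b) 1
      + ((s * ?y - r * ?x) * euler ?A w) *s axis (Inl p) 1" for w
  have fl: "f w $ Inl b = w $ Inl b - r * euler ?A w" "f w $ Inr b = w $ Inr b - s * euler ?A w"
    "f w $ Inl p = w $ Inl p + (s * ?y - r * ?x) * euler ?A w"
    "j \<noteq> b \<Longrightarrow> j \<noteq> p \<Longrightarrow> f w $ Inl j = w $ Inl j" "j \<noteq> b \<Longrightarrow> f w $ Inr j = w $ Inr j" for w j
    using pb by (simp_all add: f_def axis_def)
  have lin: "Vector_Spaces.linear (*s) (*s) f"
    by (rule vec_linearI) (simp_all add: f_def vec_eq_iff euler_add euler_scale algebra_simps)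
  have Af: "contract ?A (f w) c = contract ?A w c" "euler ?A (f w) = euler ?A w" for w c
    by (rule cong_contract; simp add: fl pA)+
  have b0: "w $ Inl b = 0" "w $ Inr b = 0" "w $ Inl p = 0" if "w \<in> radical ?A" for w
    using that pb by (auto simp: radical_def)
  have inj: "inj_on f (radical ?A)"
  proof (rule inj_onI)
    fix v w assume vw: "v \<in> radical ?A" "w \<in> radical ?A" "f v = f w"
    have "v $ c = w $ c" for c
    proof (cases c)
      case (Inl j)
      then show ?thesis
        using fl(4)[of j v] fl(4)[of j w] vw b0 by (cases "j = b \<or> j = p") auto
    next
      case (Inr j)
      then show ?thesis
        using fl(5)[of j v] fl(5)[of j w] vw b0 by (cases "j = b") auto
    qed
    then show "v = w"
      by (simp add: vec_eq_iff)
  qed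
  have "f ` radical ?A = ?K"
  proof
    show "f ` radical ?A \<subseteq> ?K"
    proof clarify
      fix w assume w: "w \<in> radical ?A"
      have k: "f w $ Inr b * ?y - f w $ Inl b * ?x + f w $ Inl p = 0"
        by (simp add: fl b0[OF w] algebra_simps)
      have eu: "euler {b..} (f w) = 0"
      proof -
        have "euler {b..} (f w) = euler ?A w - (r * ?x + s * ?y) * euler ?A w"
          by (simp add: euler_atLeast Af fl b0[OF w] algebra_simps)
        then show ?thesis
          using rs by simp
      qed
      have c: "contract {b..} (f w) (Inl j) + f w $ Inl p * a $ Inl j = 0 \<and>
          contract {b..} (f w) (Inr j) + f w $ Inl p * a $ Inr j = 0" if "b \<le> j" for j
      proof (cases "j = b")
        case True
        have "contract {b..} (f w) (Inl b) + f w $ Inl p * ?x = ?x * (1 - (r * ?x + s * ?y)) * euler ?A w"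
          by (simp add: contract_atLeast Af omA fl b0[OF w] algebra_simps)
        moreover have "contract {b..} (f w) (Inr b) + f w $ Inl p * ?y = ?y * ((r * ?x + s * ?y) - 1) * euler ?A w"
          by (simp add: contract_atLeast Af omA fl b0[OF w] algebra_simps)
        ultimately show ?thesis
          using True rs by simp
      next
        case False
        with that have j: "b < j" by simp
        have "contract {b..} (f w) (Inl j) + f w $ Inl p * a $ Inl j = contract ?A w (Inl j)
            + (f w $ Inr b * ?y - f w $ Inl b * ?x + f w $ Inl p) * a $ Inl j"
          by (simp add: contract_atLeast(1,2)[OF j] Af algebra_simps)
        moreover have "contract {b..} (f w) (Inr j) + f w $ Inl p * a $ Inr j = contract ?A w (Inr j)
            + (f w $ Inr b * ?y - f w $ Inl b * ?x + f w $ Inl p) * a $ Inr j"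
          by (simp add: contract_atLeast(1,2)[OF j] Af algebra_simps)
        ultimately show ?thesis
          using w j by (simp add: k radical_def)
      qed
      have supp: "(j \<noteq> p \<longrightarrow> f w $ Inl j = 0) \<and> f w $ Inr j = 0" if "j \<notin> {b..}" for j
        using w that by (auto simp: fl radical_def)
      have "\<phi> (f w) = 0"
        by (simp add: \<phi>_def fl b0[OF w])
      then show "f w \<in> graded_radical p {b..} \<and> \<phi> (f w) = 0"
        using c supp eu by (auto simp: graded_radical_def)
    qed
    show "?K \<subseteq> f ` radical ?A"
    proof
      fix w assume wK: "w \<in> ?K"
      then have w: "w \<in> graded_radical p {b..}" and \<phi>w: "r * w $ Inr b = s * w $ Inl b"
        by (auto simp: \<phi>_def)
      let ?k = "w $ Inr b * ?y - w $ Inl b * ?x + w $ Inl p"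
      have eu: "euler ?A w = - (w $ Inl b * ?x + w $ Inr b * ?y)"
      proof -
        have "euler {b..} w = 0"
          using w by (simp add: graded_radical_def)
        then have "euler ?A w + (w $ Inl b * ?x + w $ Inr b * ?y) = 0"
          by (simp add: euler_atLeast algebra_simps)
        then show ?thesis
          by (simp only: eq_neg_iff_add_eq_0)
      qed
      have "contract {b..} w (Inl b) + w $ Inl p * ?x = ?x * ?k"
        by (simp add: contract_atLeast omA eu algebra_simps)
      moreover have "contract {b..} w (Inr b) + w $ Inl p * ?y = ?y * ?k"
        by (simp add: contract_atLeast omA eu algebra_simps)
      ultimately have "?x * ?k = 0" "?y * ?k = 0"
        using w by (auto simp: graded_radical_def)
      with ab have k0: "?k = 0" by auto
      have cA: "contract ?A w (Inl j) = 0" "contract ?A w (Inr j) = 0" if j: "b < j" for j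
      proof -
        have "contract ?A w (Inl j) + ?k * a $ Inl j = 0" "contract ?A w (Inr j) + ?k * a $ Inr j = 0"
        proof -
          have "contract {b..} w (Inl j) + w $ Inl p * a $ Inl j = 0 \<and>
              contract {b..} w (Inr j) + w $ Inl p * a $ Inr j = 0"
            using w j by (simp add: graded_radical_def)
          then show "contract ?A w (Inl j) + ?k * a $ Inl j = 0" "contract ?A w (Inr j) + ?k * a $ Inr j = 0"
            by (simp_all add: contract_atLeast(1,2)[OF j] algebra_simps)
        qed
        then show "contract ?A w (Inl j) = 0" "contract ?A w (Inr j) = 0"
          by (simp_all add: k0)
      qed
      have wl: "w $ Inl b = - r * euler ?A w"
      proof -
        have "- r * euler ?A w = r * ?x * w $ Inl b + (r * w $ Inr b) * ?y"
          by (simp add: eu algebra_simps)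
        also have "\<dots> = (r * ?x + s * ?y) * w $ Inl b"
          by (simp only: \<phi>w) (simp add: algebra_simps)
        finally show ?thesis
          using rs by simp
      qed
      have wr: "w $ Inr b = - s * euler ?A w"
      proof -
        have "- s * euler ?A w = (s * w $ Inl b) * ?x + s * ?y * w $ Inr b"
          by (simp add: eu algebra_simps)
        also have "\<dots> = (r * ?x + s * ?y) * w $ Inr b"
          by (simp only: \<phi>w[symmetric]) (simp add: algebra_simps)
        finally show ?thesis
          using rs by simp
      qed
      have wp: "w $ Inl p = (s * ?y - r * ?x) * euler ?A w"
      proof -
        have "w $ Inl p = w $ Inl b * ?x - w $ Inr b * ?y"
          using k0 by (simp add: algebra_simps eq_neg_iff_add_eq_0)
        then show ?thesis
          by (simp add: wl wr algebra_simps)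
      qed
      define w' where "w' = w - w $ Inl b *s axis (Inl b) 1 - w $ Inr b *s axis (Inr b) 1
        - w $ Inl p *s axis (Inl p) 1"
      have w'l: "w' $ Inl b = 0" "w' $ Inr b = 0" "w' $ Inl p = 0"
        "j \<noteq> b \<Longrightarrow> j \<noteq> p \<Longrightarrow> w' $ Inl j = w $ Inl j" "j \<noteq> b \<Longrightarrow> w' $ Inr j = w $ Inr j" for j
        using pb by (simp_all add: w'_def axis_def)
      have Aw': "contract ?A w' c = contract ?A w c" "euler ?A w' = euler ?A w" for c
        by (rule cong_contract; simp add: w'l pA)+
      have "w' \<in> radical ?A"
        unfolding radical_def
      proof (intro CollectI conjI allI ballI impI)
        show "w' $ Inl j = 0" if "j \<notin> ?A" for j
          using that w w'l by (cases "j = b \<or> j = p") (auto simp: graded_radical_def)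
        show "w' $ Inr j = 0" if "j \<notin> ?A" for j
          using that w w'l by (cases "j = b") (auto simp: graded_radical_def)
        show "contract ?A w' (Inl j) = 0" "contract ?A w' (Inr j) = 0" if "j \<in> ?A" for j
          using that cA by (simp_all add: Aw')
      qed
      moreover have "f w' = w"
      proof -
        have "f w' $ c = w $ c" for c
        proof (cases c)
          case (Inl j)
          consider "j = b" | "j = p" | "j \<noteq> b" "j \<noteq> p" by blast
          then show ?thesis
            by cases (simp_all add: Inl fl w'l Aw' wl wp)
        next
          case (Inr j)
          then show ?thesis
            using wr by (cases "j = b") (simp_all add: fl w'l Aw')
        qed
        then show ?thesis
          by (simp add: vec_eq_iff)
      qed
      ultimately show "w \<in> f ` radical ?A" by blast
    qed
  qed
  then show ?thesis
    using vec_dim_image[OF subspace_radical lin inj] dim by simp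
qed

lemma radical_empty: "radical {} = {0}"
proof -
  have "w = 0" if "w \<in> radical {}" for w
  proof -
    have "w $ c = 0" for c
      using that by (cases c) (auto simp: radical_def)
    then show ?thesis
      by (simp add: vec_eq_iff)
  qed
  then show ?thesis
    using vec.subspace_0[OF subspace_radical] by blast
qed

lemma dim_graded_radical_empty: "vec.dim (graded_radical p {}) = 1"
proof -
  have "axis (Inl p) 1 \<in> graded_radical p {}"
    by (auto simp: graded_radical_def axis_nth_sum euler_def)
  then have "vec.dim (graded_radical p {}) = vec.dim {w \<in> graded_radical p {}. w $ Inl p = 0} + 1"
    by (intro vec_dim_kernel_functional[where v = "axis (Inl p) 1"] subspace_graded_radical)
      (auto simp: axis_nth_sum)
  moreover have "{w \<in> graded_radical p {}. w $ Inl p = 0} \<subseteq> radical {}"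
    by (auto simp: graded_radical_def radical_def)
  then have "vec.dim {w \<in> graded_radical p {}. w $ Inl p = 0} \<le> vec.dim (radical {})"
    by (rule vec.dim_subset)
  ultimately show ?thesis
    by (simp add: radical_empty)
qed

section \<open>From the bivector to the Hamiltonian distribution\<close>

lemma contract_UNIV: "contract UNIV w c = (\<Sum>b\<in>UNIV. w $ b * coord_bracket b c a)"
proof -
  have "(\<Sum>b\<in>UNIV. w $ b * coord_bracket b c a)
      = (\<Sum>b\<in>Inl ` UNIV. w $ b * coord_bracket b c a) + (\<Sum>b\<in>Inr ` UNIV. w $ b * coord_bracket b c a)"
    unfolding UNIV_sum by (rule sum.union_disjoint) auto
  then show ?thesis
    by (simp add: contract_def sum.distrib sum.reindex)
qed

lemma entire_linear:
  fixes w :: "complex ^ 'k::finite"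
  shows "entire (\<lambda>x. \<Sum>c\<in>UNIV. w $ c * x $ c)"
  unfolding entire_def
proof (intro allI exI conjI)
  fix x :: "complex ^ 'k"
  have "bounded_linear (\<lambda>x :: complex ^ 'k. \<Sum>c\<in>UNIV. w $ c * x $ c)"
    by (intro bounded_linear_sum bounded_linear_mult_right[THEN bounded_linear_compose] bounded_linear_vec_nth)
  then show "((\<lambda>x. \<Sum>c\<in>UNIV. w $ c * x $ c) has_derivative (\<lambda>x. \<Sum>c\<in>UNIV. w $ c * x $ c)) (at x)"
    by (rule bounded_linear_imp_has_derivative)
  show "(\<Sum>c\<in>UNIV. w $ c * (t *s v) $ c) = t * (\<Sum>c\<in>UNIV. w $ c * v $ c)" for t v
    by (simp add: sum_distrib_left mult_ac)
qed

lemma partial_deriv_linear: "partial_deriv b (\<lambda>x. \<Sum>c\<in>UNIV. w $ c * x $ c) x = w $ b"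
proof -
  have "(\<lambda>t. \<Sum>c\<in>UNIV. w $ c * (x + t *s axis b 1) $ c) = (\<lambda>t. (\<Sum>c\<in>UNIV. w $ c * x $ c) + t * w $ b)"
  proof
    fix t
    have "(\<Sum>c\<in>UNIV. w $ c * (x + t *s axis b 1) $ c)
        = (\<Sum>c\<in>UNIV. w $ c * x $ c + (if c = b then t * w $ b else 0))"
      by (intro sum.cong) (auto simp: axis_def algebra_simps)
    then show "(\<Sum>c\<in>UNIV. w $ c * (x + t *s axis b 1) $ c) = (\<Sum>c\<in>UNIV. w $ c * x $ c) + t * w $ b"
      by (simp add: sum.distrib)
  qed
  moreover have "deriv (\<lambda>t. s + t * w $ b) 0 = w $ b" for s
    by (intro DERIV_imp_deriv) (auto intro!: derivative_eq_intros)
  ultimately show ?thesis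
    by (simp add: partial_deriv_def)
qed

lemma partial_deriv_coordinate: "partial_deriv b (\<lambda>x. x $ c) (x :: complex ^ ('n + 'n)) = (if b = c then 1 else 0)"
proof -
  have "(\<lambda>x :: complex ^ ('n + 'n). x $ c) = (\<lambda>x. \<Sum>c'\<in>UNIV. axis c 1 $ c' * x $ c')"
    by (simp add: axis_def if_distrib if_distribR cong: if_cong)
  then show ?thesis
    by (simp only: partial_deriv_linear) (simp add: axis_def)
qed

definition sharp :: "complex ^ ('n + 'n) \<Rightarrow> complex ^ ('n + 'n)" where
  "sharp w = (\<chi> c. contract UNIV w c)"

lemma linear_sharp: "Vector_Spaces.linear (*s) (*s) sharp"
  by (rule vec_linearI) (simp_all add: sharp_def vec_eq_iff contract_add contract_scale)

lemma hamiltonian_field_sharp: "hamiltonian_field f a = sharp (\<chi> b. partial_deriv b f a)"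
proof -
  have "hamiltonian_field f a $ c = sharp (\<chi> b. partial_deriv b f a) $ c" for c
  proof -
    have "hamiltonian_field f a $ c
        = (\<Sum>b\<in>UNIV. \<Sum>c'\<in>UNIV. if c' = c then partial_deriv b f a * coord_bracket b c' a else 0)"
      unfolding hamiltonian_field_def poisson_bracket_def partial_deriv_coordinate vec_lambda_beta
      by (intro sum.cong refl) simp
    then show ?thesis
      by (simp add: sharp_def contract_UNIV)
  qed
  then show ?thesis
    by (simp add: vec_eq_iff)
qed

text \<open>A Hamiltonian vector at \<open>a\<close> depends only on the gradient there, and linear
  functions, which are entire, have every gradient; so the Hamiltonian vectors already form a
  subspace.\<close>

lemma hamiltonian_distribution_eq: "hamiltonian_distribution a = range sharp"
proof -
  have "{hamiltonian_field f a | f. entire f} = range sharp"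
  proof (intro equalityI subsetI)
    fix v assume "v \<in> range sharp"
    then obtain w where v: "v = sharp w" by blast
    have "hamiltonian_field (\<lambda>x. \<Sum>c\<in>UNIV. w $ c * x $ c) a = sharp w"
      by (simp add: hamiltonian_field_sharp partial_deriv_linear)
    with v show "v \<in> {hamiltonian_field f a | f. entire f}"
      by (intro CollectI exI[of _ "\<lambda>x. \<Sum>c\<in>UNIV. w $ c * x $ c"]) (simp add: entire_linear)
  qed (auto simp: hamiltonian_field_sharp)
  moreover have "vec.subspace (range sharp)"
    by (rule vec.linear_subspace_image[OF linear_sharp vec.subspace_UNIV])
  ultimately show ?thesis
    by (simp add: hamiltonian_distribution_def vec.span_eq_iff[THEN iffD2])
qed

lemma dim_hamiltonian_distribution:
  "vec.dim (hamiltonian_distribution a) + vec.dim (radical UNIV) = 2 * CARD('n)"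
proof -
  have "{w. sharp w = 0} = radical UNIV"
  proof -
    have "sharp w = 0 \<longleftrightarrow> w \<in> radical UNIV" for w
    proof -
      have "sharp w = 0 \<longleftrightarrow> (\<forall>c. contract UNIV w c = 0)"
        by (simp add: sharp_def vec_eq_iff)
      also have "\<dots> \<longleftrightarrow> (\<forall>j. contract UNIV w (Inl j) = 0 \<and> contract UNIV w (Inr j) = 0)"
        by (metis sum.exhaust)
      finally show ?thesis
        by (simp add: radical_def)
    qed
    then show ?thesis by blast
  qed
  then show ?thesis
    using vec_rank_nullity[OF linear_sharp] by (simp add: hamiltonian_distribution_eq card_UNIV_sum)
qed

end

text \<open>The derivative \<open>D\<close> of a chart is known to be complex-linear only on
  \<open>W\<close>. It is replaced by a complex-linear map on the whole space that agrees with it on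
  \<open>W\<close> and is injective there.\<close>

lemma integral_manifold_dim:
  fixes p :: "complex ^ 'k::finite"
  assumes M: "integral_manifold \<Delta> d M" and p: "p \<in> topspace M"
  shows "vec.dim (\<Delta> p) = d"
proof -
  obtain W B \<phi> where chart: "holomorphic_chart M W B \<phi>" and d: "vec.dim W = d" and "p \<in> \<phi> ` B"
    using M p unfolding integral_manifold_def immersed_submanifold_def by blast
  then obtain x where x: "x \<in> B" "p = \<phi> x" by blast
  have W: "vec.subspace W"
    using chart by (simp add: holomorphic_chart_def)
  obtain D where D: "(\<phi> has_derivative D) (at x within B)"
    and hom: "\<And>c w. w \<in> W \<Longrightarrow> D (c *s w) = c *s D w" and inj: "inj_on D W"
    using chart x(1) unfolding holomorphic_chart_def by blast
  have img: "D ` W = \<Delta> p"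
    using M chart x D unfolding integral_manifold_def by blast
  have add: "D (v + w) = D v + D w" and zero: "D 0 = 0" for v w
    using has_derivative_linear[OF D] by (simp_all add: linear_add linear_0)
  obtain C where C: "C \<subseteq> W" "vec.independent C" "W \<subseteq> vec.span C"
    using vec.basis_exists[of W] by metis
  obtain g where g: "Vector_Spaces.linear (*s) (*s) g" "\<And>x. x \<in> C \<Longrightarrow> g x = D x"
    using vec.linear_independent_extend[OF C(2), of D] by blast
  have gD: "g w = D w" if "w \<in> vec.span C" for w
    using that
  proof (induction rule: vec.span_induct_alt)
    case base
    then show ?case
      by (simp add: zero vec.linear_0[OF g(1)])
  next
    case (step c x y)
    then show ?case
      using C(1) by (auto simp: add hom g(2) vec.linear_add[OF g(1)] vec.linear_scale[OF g(1)])
  qed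
  then have "g w = D w" if "w \<in> W" for w
    using C(3) that by blast
  then have "g ` W = \<Delta> p" "inj_on g W"
    using img inj by (auto simp: inj_on_def)
  then show ?thesis
    using vec_dim_image[OF W g(1)] d by simp
qed

section \<open>The dimension formula for irreducible representations\<close>

context oscillator_representation
begin

context
  fixes pt :: "complex ^ ('n + 'n)"
  assumes pt: "\<And>i. a i = pt $ Inl i" "\<And>i. as i = pt $ Inr i"
begin

interpretation poisson_point pt .

lemma om_omega: "om A = omega A"
  by (simp add: om_def omega_def pt)

text \<open>Both states are treated together, because \<open>reduce_to_graded\<close> leads from the
  first to the second and \<open>reduce_graded\<close> back. \<open>2 * r\<close> is the rank of the
  bivector on \<open>A\<close>, or of the bordered one in \<open>2 * card A + 1\<close> variables;
  \<open>p\<close> is a place below \<open>A\<close> for the bordering component.\<close>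

lemma has_dim_radical:
  assumes "finite A" "\<forall>i\<in>A. \<forall>j. i < j \<longrightarrow> j \<in> A"
  shows "(irreducible_on (ops A) W \<longrightarrow>
      (\<exists>r. has_dim W (m ^ r) \<and> 2 * r + vec.dim (radical A) = 2 * card A)) \<and>
    (irreducible_on (insert x (ops A)) W \<and> grading A x \<kappa> \<and> (\<forall>v. (x ^^ m) v = \<xi> \<cdot> v) \<and> \<xi> \<noteq> 0 \<and>
      omega A = 0 \<and> (\<forall>j\<in>A. p < j) \<longrightarrow>
      (\<exists>r. has_dim W (m ^ r) \<and> 2 * r + vec.dim (graded_radical p A) = 2 * card A + 1))"
  using assms
proof (induction A arbitrary: W x \<kappa> \<xi> p rule: finite_linorder_min_induct)
  case empty
  have dim0: "vec.dim (radical {}) = 0"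
    by (simp add: radical_empty)
  have "has_dim W 1" if "irreducible_on (ops {}) W"
    by (rule irreducible_scalar_dim[OF that]) (simp add: ops_def)
  moreover have "has_dim W 1"
    if irr: "irreducible_on (insert x (ops {})) W" and x: "grading {} x \<kappa>" "\<forall>v. (x ^^ m) v = \<xi> \<cdot> v"
  proof (rule irreducible_scalar_dim[OF irr])
    fix g assume "g \<in> insert x (ops {})"
    then have [simp]: "g = x"
      by (simp add: ops_def)
    have "lin x" "x ` W \<subseteq> W"
      using irreducible_onD(3,4)[OF irr, of x] by simp_all
    \<comment> \<open>With no generators left, the leftover is central and hence a scalar, so it
      contributes no factor \<open>m\<close>.\<close>
    then obtain c where "\<And>v. v \<in> W \<Longrightarrow> x v = c \<cdot> v"
      by (rule central_scalar[OF irr _ _ m_pos _ _ prim, of x \<xi>]) (use x in \<open>auto simp: ops_def\<close>)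
    then show "\<exists>c. \<forall>v\<in>W. g v = c \<cdot> v" by auto
  qed
  ultimately show ?case
    using dim0 dim_graded_radical_empty[of p] by (auto intro!: exI[of _ 0])
next
  case (insert b A)
  have A: "A = {b<..}"
    using insert.hyps insert.prems by auto
  have bA: "insert b A = {b..}"
    by (auto simp: A)
  have "b \<notin> A"
    using insert.hyps by auto
  then have card: "card {b..} = card A + 1"
    using insert.hyps by (simp flip: bA)
  have up: "\<forall>i\<in>A. \<forall>j. i < j \<longrightarrow> j \<in> A"
    by (auto simp: A)
  have IH0: "\<exists>r. has_dim W (m ^ r) \<and> 2 * r + vec.dim (radical A) = 2 * card A"
    if "irreducible_on (ops A) W" for W
    using insert.IH[OF up] that by blast
  have IH1: "\<exists>r. has_dim W (m ^ r) \<and> 2 * r + vec.dim (graded_radical p A) = 2 * card A + 1"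
    if "irreducible_on (insert x (ops A)) W" "grading A x \<kappa>" "\<And>v. (x ^^ m) v = \<xi> \<cdot> v" "\<xi> \<noteq> 0"
      "omega A = 0" "\<And>j. j \<in> A \<Longrightarrow> p < j" for W x \<kappa> \<xi> p
    using insert.IH[OF up] that by blast
  have "\<exists>r. has_dim W (m ^ r) \<and> 2 * r + vec.dim (radical {b..}) = 2 * card {b..}"
    if irr: "irreducible_on (ops {b..}) W"
  proof (cases "om A = 0")
    case False
    obtain W' where W': "irreducible_on (ops A) W'" "\<And>n. has_dim W' n \<Longrightarrow> has_dim W (m * n)"
      using reduce_nonzero[OF irr] False unfolding A by blast
    obtain r where "has_dim W' (m ^ r)" "2 * r + vec.dim (radical A) = 2 * card A"
      using IH0[OF W'(1)] by blast
    \<comment> \<open>The factor \<open>m\<close> matches two more coordinates with a radical of the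
      same dimension.\<close>
    then show ?thesis
      using W'(2) dim_radical_nonzero[of b] False card
      by (intro exI[of _ "Suc r"]) (auto simp: A om_omega)
  next
    case om: True
    show ?thesis
    proof (cases "a b = 0 \<and> as b = 0")
      case True
      then have "irreducible_on (ops A) W"
        using reduce_trivial[of "{}" b W] irr om by (simp add: A)
      from IH0[OF this] show ?thesis
        using dim_radical_trivial[of b] om True card by (auto simp: A om_omega pt)
    next
      case False
      obtain x \<kappa> \<xi> where x: "grading A x \<kappa>" "\<And>v. (x ^^ m) v = \<xi> \<cdot> v" "\<xi> \<noteq> 0"
        "irreducible_on (insert x (ops A)) W"
        using reduce_to_graded[OF irr] om False unfolding A by blast
      \<comment> \<open>The bordering component is stored at the index \<open>b\<close> just
        removed.\<close>
      have "\<exists>r. has_dim W (m ^ r) \<and> 2 * r + vec.dim (graded_radical b A) = 2 * card A + 1"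
        using om by (intro IH1[OF x(4) x(1) x(2,3)]) (auto simp: om_omega A)
      then show ?thesis
        using dim_radical_graded[of b] om False card by (auto simp: A om_omega pt)
    qed
  qed
  moreover have "\<exists>r. has_dim W (m ^ r) \<and> 2 * r + vec.dim (graded_radical p {b..}) = 2 * card {b..} + 1"
    if irr: "irreducible_on (insert x (ops {b..})) W" and x: "grading {b..} x \<kappa>"
      "\<And>v. (x ^^ m) v = \<xi> \<cdot> v" "\<xi> \<noteq> 0" and om: "omega {b..} = 0" and p: "\<And>j. j \<in> {b..} \<Longrightarrow> p < j"
  proof (cases "a b = 0 \<and> as b = 0")
    case True
    have omA: "omega A = 0"
      using om True omega_atLeast[of b] by (simp add: A pt)
    have gA: "grading A x \<kappa>"
      by (rule grading_mono[OF x(1)]) (auto simp: A)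
    have "irreducible_on (insert x (ops A)) W"
      using reduce_trivial[of "{x}" b W] irr x(1) omA True by (auto simp: A om_omega)
    then have "\<exists>r. has_dim W (m ^ r) \<and> 2 * r + vec.dim (graded_radical p A) = 2 * card A + 1"
      by (rule IH1[OF _ gA x(2,3) omA]) (use p in \<open>auto simp: A\<close>)
    then show ?thesis
      using dim_graded_radical_trivial[of b p] omA True p card by (auto simp: A pt)
  next
    case False
    obtain W' where W': "irreducible_on (ops A) W'" "\<And>n. has_dim W' n \<Longrightarrow> has_dim W (m * n)"
      using reduce_graded[OF irr x] om False unfolding A by (auto simp: om_omega)
    obtain r where "has_dim W' (m ^ r)" "2 * r + vec.dim (radical A) = 2 * card A"
      using IH0[OF W'(1)] by blast
    \<comment> \<open>The right-hand side grows by 3 and the radical by 1, which leaves 2 for the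
      new factor \<open>m\<close>.\<close>
    then show ?thesis
      using W'(2) dim_graded_radical[of b p] False om p card
      by (intro exI[of _ "Suc r"]) (auto simp: A pt)
  qed
  ultimately show ?case
    unfolding bA by blast
qed

theorem irreducible_dim:
  assumes "irreducible_on (ops UNIV) W"
  shows "\<exists>r. has_dim W (m ^ r) \<and> vec.dim (hamiltonian_distribution pt) = 2 * r"
proof -
  obtain r where "has_dim W (m ^ r)" "2 * r + vec.dim (radical UNIV) = 2 * CARD('n)"
    using has_dim_radical[of UNIV W, THEN conjunct1] assms by auto
  then show ?thesis
    using dim_hamiltonian_distribution by auto
qed

end

end

section \<open>Modules over the algebra\<close>

lemma ring_free_algebra: "ring (free_algebra :: 'g free_alg ring)"
proof (rule ringI)
  show "abelian_group (free_algebra :: 'g free_alg ring)"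
  proof (rule abelian_groupI)
    fix x :: "'g free_alg"
    show "\<exists>y\<in>carrier free_algebra. y \<oplus>\<^bsub>free_algebra\<^esub> x = \<zero>\<^bsub>free_algebra\<^esub>"
      by (rule bexI[of _ "- x"]) (simp_all add: free_algebra_def)
  qed (simp_all add: free_algebra_def add.assoc add.commute)
  show "Group.monoid (free_algebra :: 'g free_alg ring)"
    by (rule Group.monoidI) (simp_all add: free_algebra_def mult.assoc)
qed (simp_all add: free_algebra_def distrib_left distrib_right)

lemma free_alg_induct [case_names const var add mult]:
  fixes x :: "'g free_alg"
  assumes const: "\<And>c. P (const_alg c)" and var: "\<And>g. P (var_alg g)"
    and add: "\<And>x y. P x \<Longrightarrow> P y \<Longrightarrow> P (x + y)" and mult: "\<And>x y. P x \<Longrightarrow> P y \<Longrightarrow> P (x * y)"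
  shows "P x"
proof (induction x rule: Poly_Mapping.update_induct)
  case const
  have "const_alg 0 = (0 :: 'g free_alg)"
    by (simp add: const_alg_def)
  then show ?case
    using assms(1)[of 0] by simp
next
  case (update f w c)
  have word: "P (Poly_Mapping.single (Word xs) c)" for xs :: "'g list"
  proof (induction xs)
    case Nil
    then show ?case
      using assms(1)[of c] by (simp add: const_alg_def zero_word_def)
  next
    case (Cons x xs)
    have "Poly_Mapping.single (Word (x # xs)) c = var_alg x * Poly_Mapping.single (Word xs) c"
      by (simp add: var_alg_def mult_single)
    then show ?case
      using mult[OF var Cons] by simp
  qed
  have "Poly_Mapping.update w c f = f + Poly_Mapping.single w c"
    using update(1)
    by (intro poly_mapping_eqI) (auto simp: lookup_update lookup_add lookup_single in_keys_iff when_def)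
  then show ?case
    using add[OF update(3) word] by (cases w) simp
qed

section \<open>The quotient by the relations\<close>

lemma Fq_ideal: "ideal (Fq_ideal q :: ('n::{finite,linorder} + 'n) free_alg set) free_algebra"
  and Fq_relations_subset: "Fq_relations q \<subseteq> (Fq_ideal q :: ('n + 'n) free_alg set)"
proof -
  interpret ring "free_algebra :: ('n + 'n) free_alg ring"
    by (rule ring_free_algebra)
  show "ideal (Fq_ideal q :: ('n + 'n) free_alg set) free_algebra"
    unfolding Fq_ideal_def by (rule genideal_ideal) (simp add: free_algebra_def)
  show "Fq_relations q \<subseteq> (Fq_ideal q :: ('n + 'n) free_alg set)"
    unfolding Fq_ideal_def by (rule genideal_self) (simp add: free_algebra_def)
qed

lemma Fq_ring: "ring (Fq q :: ('n::{finite,linorder} + 'n) free_alg set ring)"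
  unfolding Fq_def by (rule ideal.quotient_is_ring[OF Fq_ideal])

lemma Fq_class_hom: "Fq_class q \<in> ring_hom free_algebra (Fq q :: ('n::{finite,linorder} + 'n) free_alg set ring)"
proof -
  have "(+>\<^bsub>free_algebra\<^esub>) (Fq_ideal q) \<in> ring_hom free_algebra (Fq q :: ('n + 'n) free_alg set ring)"
    unfolding Fq_def by (rule ideal.rcos_ring_hom[OF Fq_ideal])
  moreover have "Fq_class q = (+>\<^bsub>free_algebra\<^esub>) (Fq_ideal q :: ('n + 'n) free_alg set)"
    by (rule ext) (simp add: Fq_class_def)
  ultimately show ?thesis by simp
qed

lemma Fq_class_carrier: "Fq_class q x \<in> carrier (Fq q)"
  by (rule ring_hom_closed[OF Fq_class_hom]) (simp add: free_algebra_def)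

lemma carrier_Fq: "X \<in> carrier (Fq q) \<Longrightarrow> \<exists>x. X = Fq_class q x"
  by (auto simp: Fq_def FactRing_def A_RCOSETS_def' Fq_class_def)

lemma Fq_class_relation:
  assumes "x \<in> Fq_relations q"
  shows "Fq_class q x = Fq_class q 0"
proof -
  interpret R: ring "free_algebra :: ('n::{finite,linorder} + 'n) free_alg ring"
    by (rule ring_free_algebra)
  have "x \<in> Fq_ideal q"
    using assms Fq_relations_subset by blast
  moreover have "0 \<in> Fq_ideal q"
    using additive_subgroup.zero_closed[OF ideal.axioms(1)[OF Fq_ideal]]
    by (simp add: free_algebra_def)
  ultimately show ?thesis
    unfolding Fq_class_def using R.a_rcos_zero[OF Fq_ideal] by metis
qed

lemma Fq_relationsI:
  fixes i j :: "'n::{finite,linorder}"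
  defines "z \<equiv> \<lambda>i. var_alg (Inl i) :: ('n + 'n) free_alg"
    and "zs \<equiv> \<lambda>i. var_alg (Inr i) :: ('n + 'n) free_alg"
  shows "i < j \<Longrightarrow> z i * z j - const_alg (inverse q) * z j * z i \<in> Fq_relations q"
    and "i < j \<Longrightarrow> zs i * zs j - const_alg q * zs j * zs i \<in> Fq_relations q"
    and "i \<noteq> j \<Longrightarrow> z i * zs j - const_alg (inverse q) * zs j * z i \<in> Fq_relations q"
    and "z i * zs i - zs i * z i - const_alg (q\<^sup>2 - 1) * (\<Sum>k\<in>{k. i < k}. z k * zs k) \<in> Fq_relations q"
  unfolding Fq_relations_def Let_def z_def zs_def by (simp, blast)+

section \<open>The free algebra acting through the quotient\<close>

locale Fq_representation =
  fixes q :: complex and smul :: "complex \<Rightarrow> 'v::ab_group_add \<Rightarrow> 'v"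
    and \<rho> :: "('n::{finite,linorder} + 'n) free_alg set \<Rightarrow> 'v \<Rightarrow> 'v"
  assumes module: "Fq_module q smul \<rho>"
begin

sublocale complex_vector_space smul
  using module by (simp add: Fq_module_def complex_vector_space_def)

definition act :: "('n + 'n) free_alg \<Rightarrow> 'v \<Rightarrow> 'v" where
  "act x = \<rho> (Fq_class q x)"

lemma hom: "\<rho> \<in> ring_hom (Fq q) (End_ring smul)"
  using module by (simp add: Fq_module_def)

lemma lin_act: "lin (act x)"
  using ring_hom_closed[OF hom Fq_class_carrier] by (simp add: act_def End_ring_def)

lemma act_add: "act (x + y) v = act x v + act y v"
proof -
  have "Fq_class q (x + y) = Fq_class q x \<oplus>\<^bsub>Fq q\<^esub> Fq_class q y"
    using ring_hom_add[OF Fq_class_hom, of x y q] by (simp add: free_algebra_def)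
  then show ?thesis
    using ring_hom_add[OF hom Fq_class_carrier Fq_class_carrier] by (simp add: act_def End_ring_def)
qed

lemma act_mult: "act (x * y) v = act x (act y v)"
proof -
  have "Fq_class q (x * y) = Fq_class q x \<otimes>\<^bsub>Fq q\<^esub> Fq_class q y"
    using ring_hom_mult[OF Fq_class_hom, of x y q] by (simp add: free_algebra_def)
  then show ?thesis
    using ring_hom_mult[OF hom Fq_class_carrier Fq_class_carrier] by (simp add: act_def End_ring_def)
qed

lemma act_const: "act (const_alg c) v = smul c v"
  using module by (simp add: Fq_module_def act_def)

lemma act_0: "act 0 v = 0"
  using act_add[of 0 0 v] by simp

lemma act_sum: "act (\<Sum>i\<in>I. f i) v = (\<Sum>i\<in>I. act (f i) v)"
  by (induction I rule: infinite_finite_induct) (simp_all add: act_0 act_add)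

lemma act_relation:
  assumes "x - y \<in> Fq_relations q"
  shows "act x v = act y v"
proof -
  have "act (x - y) v = 0"
    using Fq_class_relation[OF assms] act_0 by (simp add: act_def)
  then show ?thesis
    using act_add[of "x - y" y v] by simp
qed

lemma \<rho>_pow: "\<rho> (Fq_class q x [^]\<^bsub>Fq q\<^esub> n) = act x ^^ n"
proof (induction n)
  case 0
  show ?case
    using ring_hom_one[OF hom] by (simp add: End_ring_def)
next
  case (Suc n)
  interpret ring "Fq q :: ('n + 'n) free_alg set ring"
    by (rule Fq_ring)
  show ?case
    using ring_hom_mult[OF hom nat_pow_closed[OF Fq_class_carrier] Fq_class_carrier] Suc
    by (simp add: End_ring_def act_def funpow_Suc_right del: funpow.simps)
qed

abbreviation Z where "Z i \<equiv> act (var_alg (Inl i))"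
abbreviation Zs where "Zs i \<equiv> act (var_alg (Inr i))"

lemma act_relations:
  shows "i < j \<Longrightarrow> Z i (Z j v) = smul (inverse q) (Z j (Z i v))"
    and "i < j \<Longrightarrow> Zs i (Zs j v) = smul q (Zs j (Zs i v))"
    and "i \<noteq> j \<Longrightarrow> Z i (Zs j v) = smul (inverse q) (Zs j (Z i v))"
    and "Z i (Zs i v) - Zs i (Z i v) = smul (q\<^sup>2 - 1) (\<Sum>k\<in>{k. i < k}. Z k (Zs k v))"
proof -
  show "i < j \<Longrightarrow> Z i (Z j v) = smul (inverse q) (Z j (Z i v))"
    using act_relation[OF Fq_relationsI(1)] by (simp add: act_mult act_const)
  show "i < j \<Longrightarrow> Zs i (Zs j v) = smul q (Zs j (Zs i v))"
    using act_relation[OF Fq_relationsI(2)] by (simp add: act_mult act_const)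
  show "i \<noteq> j \<Longrightarrow> Z i (Zs j v) = smul (inverse q) (Zs j (Z i v))"
    using act_relation[OF Fq_relationsI(3)] by (simp add: act_mult act_const)
  show "Z i (Zs i v) - Zs i (Z i v) = smul (q\<^sup>2 - 1) (\<Sum>k\<in>{k. i < k}. Z k (Zs k v))"
    using act_relation[OF Fq_relationsI(4)[of i q, unfolded diff_diff_eq], of v]
    by (simp add: act_mult act_const act_add act_sum)
qed

lemma stable_act:
  assumes U: "subspace U" and Z: "\<And>i. Z i ` U \<subseteq> U" and Zs: "\<And>i. Zs i ` U \<subseteq> U"
  shows "act x ` U \<subseteq> U"
proof (induction x rule: free_alg_induct)
  case (const c)
  then show ?case
    using subspace_scale[OF U] by (auto simp: act_const)
next
  case (var g)
  then show ?case
    using Z Zs by (cases g) auto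
next
  case (add x y)
  then show ?case
    using subspace_add[OF U] by (auto simp: act_add)
next
  case (mult x y)
  then show ?case
    by (auto simp: act_mult)
qed

end

theorem theorem6p1:
  fixes m d :: nat
    and q :: complex
    and smul :: "complex \<Rightarrow> 'v::ab_group_add \<Rightarrow> 'v"
    and \<rho> :: "('n::{finite,linorder} + 'n) free_alg set \<Rightarrow> 'v \<Rightarrow> 'v"
    and a :: "complex ^ ('n + 'n)"
    and leaf :: "(complex ^ ('n + 'n)) topology"
  assumes "odd m"
    and "primitive_root_of_unity m q"
    and "irreducible_Fq_module q smul \<rho>"
    and "\<And>i v. \<rho> (Fq_z q i [^]\<^bsub>Fq q\<^esub> m) v = smul (a $ Inl i) v"
    and "\<And>i v. \<rho> (Fq_zstar q i [^]\<^bsub>Fq q\<^esub> m) v = smul (a $ Inr i) v"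
    and "symplectic_leaf d leaf"
    and "a \<in> topspace leaf"
  shows "real (vector_space.dim smul (UNIV :: 'v set)) = real m powr (1 / 2 * real d)"
proof -
  interpret Fq_representation q smul \<rho>
    using assms(3) by unfold_locales (simp add: irreducible_Fq_module_def)
  interpret osc: oscillator_representation smul q m Z Zs "\<lambda>i. a $ Inl i" "\<lambda>i. a $ Inr i"
  proof unfold_locales
    show "(Z i ^^ m) v = smul (a $ Inl i) v" "(Zs i ^^ m) v = smul (a $ Inr i) v" for i v
      using assms(4,5)[of i v] by (simp_all only: \<rho>_pow)
  qed (fact assms(1,2) | rule lin_add[OF lin_act] lin_scale[OF lin_act] act_relations; assumption?)+
  have "irreducible_on (osc.ops UNIV) UNIV"
    unfolding irreducible_on_def
  proof (intro conjI ballI allI impI)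
    show "(UNIV :: 'v set) \<noteq> {0}"
      using assms(3) by (simp add: irreducible_Fq_module_def)
    show "lin g" if "g \<in> osc.ops UNIV" for g
      by (rule osc.lin_ops[OF that])
    fix U assume U: "subspace U \<and> U \<subseteq> UNIV \<and> (\<forall>g\<in>osc.ops UNIV. g ` U \<subseteq> U)"
    \<comment> \<open>Every element of the quotient is the class of an element of the free algebra,
      so stability under the generators gives a submodule.\<close>
    have "\<rho> X u \<in> U" if X: "X \<in> carrier (Fq q)" and u: "u \<in> U" for X u
    proof -
      obtain x where "X = Fq_class q x"
        using carrier_Fq[OF X] by blast
      moreover have "act x ` U \<subseteq> U"
      proof (rule stable_act)
        show "subspace U"
          using U by simp
        have "Z i \<in> osc.ops UNIV" "Zs i \<in> osc.ops UNIV" for i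
          by (simp_all add: osc.ops_def)
        with U show "Z i ` U \<subseteq> U" "Zs i ` U \<subseteq> U" for i
          by simp_all
      qed
      ultimately show ?thesis
        using u unfolding act_def by blast
    qed
    then show "U = {0} \<or> U = UNIV"
      using assms(3) U by (simp add: irreducible_Fq_module_def)
  qed simp_all
  then obtain r where r: "has_dim UNIV (m ^ r)" "vec.dim (hamiltonian_distribution a) = 2 * r"
    using osc.irreducible_dim[of a UNIV] by auto
  have "integral_manifold hamiltonian_distribution d leaf"
    using assms(6) by (simp add: symplectic_leaf_def)
  \<comment> \<open>The tangent space of the leaf at \<open>a\<close> is the Hamiltonian
    distribution, whose dimension is known from the representation.\<close>
  then have "d = 2 * r"
    using integral_manifold_dim[OF _ assms(7)] r(2) by blast
  moreover have "dim (UNIV :: 'v set) = m ^ r"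
    by (rule has_dim_imp_dim[OF r(1)])
  ultimately show ?thesis
    using osc.m_pos by (simp add: powr_realpow)
qed

end
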